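(* Let $D\ge 3$. For each $N\ge 1$ let $\mathbb T=(\mathbb T_{\vec n})_{\vec n\in\{1,\dots,N\}^D}$ be $N^D$ complex random variables whose joint distribution $\mu_N$ is even and trace invariant, and suppose that $(\mu_N)_N$ is properly uniformly bounded, with covariance $K(\mathcal B^{(2)},N)$. Then, as $N\to\infty$, the tensor $\mathbb T$ converges in distribution to a Gaussian tensor of covariance $K(\mathcal B^{(2)})=\lim_{N\to\infty}K(\mathcal B^{(2)},N)$; that is, for every connected closed $D$-colored graph $\mathcal B$, $$\lim_{N\to\infty}N^{-1+\Omega(\mathcal B)}\;\mu_N\big[\mathrm{Tr}_{\mathcal B}(\mathbb T,\bar{\mathbb T})\big]=K(\mathcal B^{(2)})^{k(\mathcal B)}\,R(\mathcal B).$$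
   Context: Colored graphs. A closed $D$-colored graph $\mathcal B$ (not necessarily connected) is a finite bipartite multigraph, with vertices split into white vertices $v$ and black vertices $\bar v$ in equal numbers, every edge joining a white and a black vertex and carrying a color in $\{1,\dots,D\}$, such that every vertex is incident to exactly one edge of each color. $2k(\mathcal B)$ is its number of vertices, $C(\mathcal B)$ its number of connected components, $\mathcal E^i(\mathcal B)$ its set of edges of color $i$. $\mathcal B^{(2)}$ (the $D$-dipole) is the unique $D$-colored graph with two vertices. Closed $(D+1)$-colored graphs are defined in the same way with colors $\{0,1,\dots,D\}$. For colors $i\ne j$, a face of colors $ij$ is a connected component of the subgraph formed by the edges of colors $i$ and $j$; $F^{ij}$ is the number of such faces. Trace invariants. Assign indices $\vec n_v=(n^1_v,\dots,n^D_v)$ to white vertices and $\vec{\bar n}_{\bar v}$ to black vertices, all in $\{1,\dots,N\}$. The trace invariant operator is $\delta^{\mathcal B}_{n\bar n}=\prod_{i=1}^D\prod_{(v,\bar v)\in\mathcal E^i(\mathcal B)}\delta_{n^i_v\bar n^i_{\bar v}}$ (it factors over connected components) and $\mathrm{Tr}_{\mathcal B}(\mathbb T,\bar{\mathbb T})=\sum_{n,\bar n}\delta^{\mathcal B}_{n\bar n}\prod_v\mathbb T_{\vec n_v}\prod_{\bar v}\bar{\mathbb T}_{\vec{\bar n}_{\bar v}}$. Distributions. $\mu_N[\cdot]$ denotes expectation; all joint moments of the entries and their conjugates are assumed finite. Even: a joint moment is zero unless it contains equally many entries $\mathbb T$ and $\bar{\mathbb T}$. The joint cumulants $\kappa_{2k}$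 are defined from the joint moments by $\mu_N(\mathbb T_{\vec n_1},\bar{\mathbb T}_{\vec{\bar n}_{\bar 1}},\dots,\mathbb T_{\vec n_k},\bar{\mathbb T}_{\vec{\bar n}_{\bar k}})=\sum_\pi\prod_\alpha\kappa_{2k(\alpha)}[\dots]$, where $\pi$ runs over the partitions of $\{1,\dots,k,\bar1,\dots,\bar k\}$ into blocks each containing as many unbarred as barred elements ($k(\alpha)$ of each in block $\alpha$). $\mu_N$ is trace invariant if for all $k\ge1$ $$\kappa_{2k}[\mathbb T_{\vec n_1},\bar{\mathbb T}_{\vec{\bar n}_{\bar1}},\dots,\mathbb T_{\vec n_k},\bar{\mathbb T}_{\vec{\bar n}_{\bar k}}]=\sum_{\mathcal B,\;k(\mathcal B)=k}\mathfrak K(\mathcal B,\mu_N)\,\delta^{\mathcal B}_{n\bar n}$$ for some coefficients $\mathfrak K(\mathcal B,\mu_N)$, the sum running over all (possibly disconnected) closed $D$-colored graphs with white vertices labeled $1,\dots,k$ and black vertices labeled $\bar1,\dots,\bar k$. Set $$K(\mathcal B,N)=\frac{\mathfrak K(\mathcal B,\mu_N)}{N^{-2(D-1)k(\mathcal B)+D-C(\mathcal B)}}.$$ $K(\mathcal B^{(2)},N)$ is called the covariance of $\mu_N$. The family $\mu_N$ is properly uniformly bounded if $\lim_{N\to\infty}K(\mathcal B^{(2)},N)$ exists and is finite, and for every $\mathcal B\ne\mathcal B^{(2)}$ there is a constant $K(\mathcal B)$ with $|K(\mathcal B,N)|\le K(\mathcal B)$ for all $N$ large enough. Covering graphs. A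 covering graph of a connected closed $D$-colored graph $\mathcal B$ is a closed $(D+1)$-colored graph $\mathcal G$ on the same vertex set such that deleting the edges of color $0$ of $\mathcal G$ gives $\mathcal B$ (vertices distinguished). A minimal covering graph is one maximizing $\sum_{i=1}^DF^{0i}(\mathcal G)$. $R(\mathcal B)$ is the number of minimal covering graphs and $\Omega(\mathcal B)=1+(D-1)k(\mathcal B)-\max_{\mathcal G}\sum_{i=1}^DF^{0i}(\mathcal G)$, the maximum over covering graphs of $\mathcal B$. These are exactly the numbers such that $\lim_{N\to\infty}N^{-1+\Omega(\mathcal B)}\langle\mathrm{Tr}_{\mathcal B}(\mathbb T,\bar{\mathbb T})\rangle_{\sigma^2}=\sigma^{2k(\mathcal B)}R(\mathcal B)$, where $\langle\cdot\rangle_{\sigma^2}$ is the expectation for independent centered complex Gaussian entries with $\langle\mathbb T_{\vec n}\bar{\mathbb T}_{\vec n}\rangle=\sigma^2/N^{D-1}$. *)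

theory Defs
  imports "HOL-Probability.Probability"
begin

section \<open>Colored graphs\<close>

text \<open>
  In a closed colored graph every vertex meets exactly one edge of each color, so parallel edges
  always have different colors and a set of white-black pairs per color describes the multigraph.
\<close>

record ('w, 'b) colored_graph =
  white :: "'w set"
  black :: "'b set"
  edges :: "nat \<Rightarrow> ('w \<times> 'b) set"

text \<open>
  No edges are allowed outside the color set \<open>I\<close>: this makes equality of records coincide with
  equality of graphs, so that sums over and numbers of graphs are the intended ones.
\<close>

definition closed_colored_graph :: "nat set \<Rightarrow> ('w, 'b) colored_graph \<Rightarrow> bool" where
  "closed_colored_graph I G \<longleftrightarrow>
     finite (white G) \<and> finite (black G) \<and> card (white G) = card (black G) \<and>
     (\<forall>i\<in>I. edges G i \<subseteq> white G \<times> black G \<and>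
        (\<forall>v\<in>white G. \<exists>!w. (v, w) \<in> edges G i) \<and>
        (\<forall>w\<in>black G. \<exists>!v. (v, w) \<in> edges G i)) \<and>
     (\<forall>i. i \<notin> I \<longrightarrow> edges G i = {})"

definition vertices :: "('w, 'b) colored_graph \<Rightarrow> ('w + 'b) set" where
  "vertices G = white G <+> black G"

definition half_order :: "('w, 'b) colored_graph \<Rightarrow> nat" where
  "half_order G = card (white G)"

definition adjacency :: "nat set \<Rightarrow> ('w, 'b) colored_graph \<Rightarrow> (('w + 'b) \<times> ('w + 'b)) set" where
  "adjacency I G = {(Inl v, Inr w) | v w. \<exists>i\<in>I. (v, w) \<in> edges G i}"

definition graph_components :: "nat set \<Rightarrow> ('w, 'b) colored_graph \<Rightarrow> ('w + 'b) set set" where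
  "graph_components I G = vertices G // (adjacency I G \<union> (adjacency I G)\<inverse>)\<^sup>*"

definition num_components :: "('w, 'b) colored_graph \<Rightarrow> nat" where
  "num_components G = card (graph_components UNIV G)"

definition connected_graph :: "('w, 'b) colored_graph \<Rightarrow> bool" where
  "connected_graph G \<longleftrightarrow> num_components G = 1"

definition num_faces :: "nat \<Rightarrow> nat \<Rightarrow> ('w, 'b) colored_graph \<Rightarrow> nat" where
  "num_faces i j G = card (graph_components {i, j} G)"

definition labeled_graphs :: "nat \<Rightarrow> nat \<Rightarrow> (nat, nat) colored_graph set" where
  "labeled_graphs D k =
     {B. closed_colored_graph {1..D} B \<and> white B = {1..k} \<and> black B = {1..k}}"

definition dipole :: "nat \<Rightarrow> (nat, nat) colored_graph" where
  "dipole D = \<lparr>white = {1}, black = {1}, edges = (\<lambda>i. if i \<in> {1..D} then {(1, 1)} else {})\<rparr>"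

section \<open>Covering graphs\<close>

definition delete_color :: "nat \<Rightarrow> ('w, 'b) colored_graph \<Rightarrow> ('w, 'b) colored_graph" where
  "delete_color i G = G\<lparr>edges := (edges G)(i := {})\<rparr>"

definition covering_graphs :: "nat \<Rightarrow> ('w, 'b) colored_graph \<Rightarrow> ('w, 'b) colored_graph set" where
  "covering_graphs D B = {G. closed_colored_graph {0..D} G \<and> delete_color 0 G = B}"

definition num_faces0 :: "nat \<Rightarrow> ('w, 'b) colored_graph \<Rightarrow> nat" where
  "num_faces0 D G = (\<Sum>i = 1..D. num_faces 0 i G)"

definition minimal_covering_graphs ::
  "nat \<Rightarrow> ('w, 'b) colored_graph \<Rightarrow> ('w, 'b) colored_graph set" where
  "minimal_covering_graphs D B =
     {G \<in> covering_graphs D B. \<forall>H\<in>covering_graphs D B. num_faces0 D H \<le> num_faces0 D G}"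

definition R_number :: "nat \<Rightarrow> ('w, 'b) colored_graph \<Rightarrow> nat" where
  "R_number D B = card (minimal_covering_graphs D B)"

definition Omega :: "nat \<Rightarrow> ('w, 'b) colored_graph \<Rightarrow> int" where
  "Omega D B = 1 + (int D - 1) * int (half_order B) - int (Max (num_faces0 D ` covering_graphs D B))"

section \<open>Trace invariants\<close>

definition tensor_indices :: "nat \<Rightarrow> nat \<Rightarrow> (nat \<Rightarrow> nat) set" where
  "tensor_indices D N = {1..D} \<rightarrow>\<^sub>E {1..N}"

text \<open>
  A single function \<open>n\<close> on \<open>'w + 'b\<close> carries the multi-indices of the white vertices (on \<open>Inl\<close>)
  and of the black vertices (on \<open>Inr\<close>).
\<close>

definition trace_operator ::
  "nat \<Rightarrow> ('w, 'b) colored_graph \<Rightarrow> ('w + 'b \<Rightarrow> nat \<Rightarrow> nat) \<Rightarrow> complex" where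
  "trace_operator D B n =
     (\<Prod>i = 1..D. \<Prod>(v, w)\<in>edges B i. if n (Inl v) i = n (Inr w) i then 1 else 0)"

definition trace_inv ::
  "nat \<Rightarrow> nat \<Rightarrow> ('w, 'b) colored_graph \<Rightarrow> ((nat \<Rightarrow> nat) \<Rightarrow> complex) \<Rightarrow> complex" where
  "trace_inv D N B T =
     (\<Sum>n \<in> vertices B \<rightarrow>\<^sub>E tensor_indices D N.
        trace_operator D B n * (\<Prod>v\<in>white B. T (n (Inl v))) * (\<Prod>w\<in>black B. cnj (T (n (Inr w)))))"

section \<open>Joint moments and cumulants\<close>

text \<open>
  Elements \<open>Inl v\<close> stand for the unbarred labels (entries of the tensor) and \<open>Inr w\<close> for the
  barred ones (conjugated entries); \<open>n\<close> may assign the same multi-index to several labels.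
\<close>

definition entry_product ::
  "((nat \<Rightarrow> nat) \<Rightarrow> 'a \<Rightarrow> complex) \<Rightarrow> ('w + 'b \<Rightarrow> nat \<Rightarrow> nat) \<Rightarrow> ('w + 'b) set \<Rightarrow> 'a \<Rightarrow> complex" where
  "entry_product T n S \<omega> =
     (\<Prod>x\<in>S. case x of Inl v \<Rightarrow> T (n x) \<omega> | Inr w \<Rightarrow> cnj (T (n x) \<omega>))"

definition joint_moment ::
  "'a measure \<Rightarrow> ((nat \<Rightarrow> nat) \<Rightarrow> 'a \<Rightarrow> complex) \<Rightarrow> ('w + 'b \<Rightarrow> nat \<Rightarrow> nat) \<Rightarrow> ('w + 'b) set \<Rightarrow> complex"
  where
  "joint_moment M T n S = (\<integral>\<omega>. entry_product T n S \<omega> \<partial>M)"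

definition balanced :: "('w + 'b) set \<Rightarrow> bool" where
  "balanced S \<longleftrightarrow> card (Inl -` S) = card (Inr -` S)"

definition balanced_partitions :: "('w + 'b) set \<Rightarrow> ('w + 'b) set set set" where
  "balanced_partitions S = {P. partition_on S P \<and> (\<forall>b\<in>P. balanced b)}"

lemma finite_balanced_partitions: "finite S \<Longrightarrow> finite (balanced_partitions S)"
  by (rule finite_subset[of _ "Pow (Pow S)"]) (auto simp: balanced_partitions_def partition_on_def)

lemma balanced_partitions_card_less:
  assumes "finite S" "P \<in> balanced_partitions S - {{S}}" "b \<in> P"
  shows "card b < card S"
proof -
  have P: "partition_on S P" using assms by (auto simp: balanced_partitions_def)
  have "b \<noteq> S"
  proof
    assume "b = S"
    have "c = S" if "c \<in> P" for c
    proof (rule ccontr)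
      assume "c \<noteq> S"
      then have "c \<inter> S = {}"
        using P that assms(3) \<open>b = S\<close> by (auto simp: partition_on_def disjoint_def)
      moreover have "c \<subseteq> S" "c \<noteq> {}" using P that by (auto simp: partition_on_def)
      ultimately show False by auto
    qed
    then have "P = {S}" using assms(3) by auto
    then show False using assms(2) by simp
  qed
  moreover have "b \<subseteq> S" using P assms(3) by (auto simp: partition_on_def)
  ultimately show ?thesis using assms(1) by (simp add: psubset_card_mono psubsetI)
qed

text \<open>
  The moment-cumulant relation solved for the term of the one-block partition; the relation itself
  is lemma \<open>moment_cumulant\<close>. The argument \<open>m\<close> assigns to a set of labels its joint moment.
\<close>

function cumulant :: "(('w + 'b) set \<Rightarrow> complex) \<Rightarrow> ('w + 'b) set \<Rightarrow> complex" where
  "cumulant m S =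
     (if finite S
      then m S - (\<Sum>P \<in> balanced_partitions S - {{S}}. \<Prod>b\<in>P. cumulant m b)
      else 0)"
  by auto
termination
  by (relation "Wellfounded.measure (\<lambda>(m, S). card S)") (auto dest: balanced_partitions_card_less)

declare cumulant.simps [simp del]

lemma moment_cumulant:
  assumes "finite S" "S \<noteq> {}" "balanced S"
  shows "m S = (\<Sum>P\<in>balanced_partitions S. \<Prod>b\<in>P. cumulant m b)"
proof -
  have "{S} \<in> balanced_partitions S"
    using assms by (auto simp: balanced_partitions_def partition_on_def)
  then show ?thesis
    using assms(1) finite_balanced_partitions[OF assms(1)]
    by (simp add: sum.remove[of _ "{S}"] cumulant.simps[of m S])
qed

section \<open>Random tensors\<close>

definition random_tensor ::
  "nat \<Rightarrow> nat \<Rightarrow> 'a measure \<Rightarrow> ((nat \<Rightarrow> nat) \<Rightarrow> 'a \<Rightarrow> complex) \<Rightarrow> bool" where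
  "random_tensor D N M T \<longleftrightarrow> prob_space M \<and> (\<forall>n\<in>tensor_indices D N. T n \<in> borel_measurable M)"

definition finite_moments ::
  "nat \<Rightarrow> nat \<Rightarrow> 'a measure \<Rightarrow> ((nat \<Rightarrow> nat) \<Rightarrow> 'a \<Rightarrow> complex) \<Rightarrow> bool" where
  "finite_moments D N M T \<longleftrightarrow>
     (\<forall>(S :: (nat + nat) set) n. finite S \<longrightarrow> n \<in> S \<rightarrow> tensor_indices D N \<longrightarrow>
        integrable M (entry_product T n S))"

definition even_distribution ::
  "nat \<Rightarrow> nat \<Rightarrow> 'a measure \<Rightarrow> ((nat \<Rightarrow> nat) \<Rightarrow> 'a \<Rightarrow> complex) \<Rightarrow> bool" where
  "even_distribution D N M T \<longleftrightarrow>
     (\<forall>(S :: (nat + nat) set) n. finite S \<longrightarrow> n \<in> S \<rightarrow> tensor_indices D N \<longrightarrow>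
        \<not> balanced S \<longrightarrow> joint_moment M T n S = 0)"

definition trace_invariant ::
  "nat \<Rightarrow> nat \<Rightarrow> 'a measure \<Rightarrow> ((nat \<Rightarrow> nat) \<Rightarrow> 'a \<Rightarrow> complex) \<Rightarrow>
     ((nat, nat) colored_graph \<Rightarrow> complex) \<Rightarrow> bool" where
  "trace_invariant D N M T \<KK> \<longleftrightarrow>
     (\<forall>k\<ge>1. \<forall>n \<in> ({1..k} <+> {1..k}) \<rightarrow> tensor_indices D N.
        cumulant (joint_moment M T n) ({1..k} <+> {1..k}) =
          (\<Sum>B\<in>labeled_graphs D k. \<KK> B * trace_operator D B n))"

definition rescaled_coeff ::
  "nat \<Rightarrow> (nat \<Rightarrow> (nat, nat) colored_graph \<Rightarrow> complex) \<Rightarrow> (nat, nat) colored_graph \<Rightarrow> nat \<Rightarrow> complex"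
  where
  "rescaled_coeff D \<KK> B N =
     \<KK> N B / of_nat N powi (- 2 * (int D - 1) * int (half_order B) + int D - int (num_components B))"

definition properly_uniformly_bounded ::
  "nat \<Rightarrow> (nat \<Rightarrow> (nat, nat) colored_graph \<Rightarrow> complex) \<Rightarrow> bool" where
  "properly_uniformly_bounded D \<KK> \<longleftrightarrow>
     convergent (rescaled_coeff D \<KK> (dipole D)) \<and>
     (\<forall>k\<ge>1. \<forall>B\<in>labeled_graphs D k. B \<noteq> dipole D \<longrightarrow>
        (\<exists>c::real. \<forall>\<^sub>F N in sequentially. norm (rescaled_coeff D \<KK> B N) \<le> c))"

section \<open>Well-definedness of the sums, cardinalities and maxima\<close>

lemma finite_closed_colored_graphs:
  assumes "finite I" "finite V" "finite W"
  shows "finite {G. closed_colored_graph I G \<and> white G = V \<and> black G = W}" (is "finite ?A")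
proof -
  define F where "F = {f. \<forall>i. (i \<in> I \<longrightarrow> f i \<in> Pow (V \<times> W)) \<and> (i \<notin> I \<longrightarrow> f i = {})}"
  have "finite F"
    unfolding F_def using assms finite_set_of_finite_funs[of I "Pow (V \<times> W)" "{}"] by simp
  moreover have "?A \<subseteq> (\<lambda>f. \<lparr>white = V, black = W, edges = f\<rparr>) ` F"
  proof
    fix G assume "G \<in> ?A"
    then have "edges G \<in> F" "G = \<lparr>white = V, black = W, edges = edges G\<rparr>"
      by (auto simp: F_def closed_colored_graph_def)
    then show "G \<in> (\<lambda>f. \<lparr>white = V, black = W, edges = f\<rparr>) ` F" by blast
  qed
  ultimately show ?thesis by (rule finite_surj)
qed

lemma finite_labeled_graphs: "finite (labeled_graphs D k)"
  unfolding labeled_graphs_def by (intro finite_closed_colored_graphs) auto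

lemma finite_covering_graphs:
  assumes "closed_colored_graph {1..D} B"
  shows "finite (covering_graphs D B)"
proof (rule finite_subset)
  show "covering_graphs D B \<subseteq>
      {G. closed_colored_graph {0..D} G \<and> white G = white B \<and> black G = black B}"
    by (auto simp: covering_graphs_def delete_color_def)
  show "finite {G. closed_colored_graph {0..D} G \<and> white G = white B \<and> black G = black B}"
    using assms by (intro finite_closed_colored_graphs) (auto simp: closed_colored_graph_def)
qed

lemma covering_graphs_nonempty:
  assumes "closed_colored_graph {1..D} B" "D \<ge> 1"
  shows "covering_graphs D B \<noteq> {}"
proof -
  define G where "G = B\<lparr>edges := (edges B)(0 := edges B 1)\<rparr>"
  have "edges B 0 = {}" using assms(1) by (simp add: closed_colored_graph_def)
  then have "(edges B)(0 := {}) = edges B" by (simp add: fun_upd_idem)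
  then have "delete_color 0 G = B" by (simp add: G_def delete_color_def)
  moreover have "closed_colored_graph {0..D} G"
    using assms by (simp add: G_def closed_colored_graph_def)
  ultimately have "G \<in> covering_graphs D B" by (simp add: covering_graphs_def)
  then show ?thesis by blast
qed

lemma labeled_graphs_1: "labeled_graphs D 1 = {dipole D}"
proof -
  have "dipole D \<in> labeled_graphs D 1"
    by (auto simp: labeled_graphs_def dipole_def closed_colored_graph_def)
  moreover have "B = dipole D" if "B \<in> labeled_graphs D 1" for B
  proof -
    have "edges B i = (if i \<in> {1..D} then {(1, 1)} else {})" for i
    proof (cases "i \<in> {1..D}")
      case True
      have B: "closed_colored_graph {1..D} B" "white B = {1}" "black B = {1}"
        using that by (simp_all add: labeled_graphs_def)
      have s: "edges B i \<subseteq> {1} \<times> {1}" and "\<forall>v\<in>{1}. \<exists>!w. (v, w) \<in> edges B i"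
        using B(1) True unfolding closed_colored_graph_def B(2,3) by metis+
      then have e: "\<exists>w. (1, w) \<in> edges B i" by blast
      from e obtain w where "(1, w) \<in> edges B i" by blast
      then show ?thesis using s True by auto
    next
      case False
      then show ?thesis using that by (auto simp: labeled_graphs_def closed_colored_graph_def)
    qed
    then have "edges B = edges (dipole D)" by (auto simp: dipole_def)
    then show ?thesis
      using that by (intro colored_graph.equality) (auto simp: labeled_graphs_def dipole_def)
  qed
  ultimately show ?thesis by blast
qed

end

(*
  Expanding moments into cumulants and cumulants into trace invariants, the expectation of the trace
  of B becomes a sum over balanced partitions of the vertices and over graphs H_b on their blocks; each
  term is a product of coefficients K(H_b, N) times N^E. Per color i the index sum counts the components
  of the union of the color-i perfect matchings of B and of the H_b. If all blocks have two vertices,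
  the H_b are dipoles and form the color-0 edges of a covering graph G, and E is the deficit of the
  number of faces of G from its maximum. Otherwise E < 0: submodularity of the number of components
  (a triangle inequality for matchings) compares the matchings of the H_b with a single matching s, which
  gives a covering graph, and a suitable s always does strictly better since D >= 3.
*)
theory Submission imports Defs begin

section \<open>Components of a relation and perfect matchings\<close>

text \<open>The coefficients are only known to be bounded, so a term with a larger block disappears
  in the limit only if its exponent is strictly negative. This strictness is the obstacle. Write k
  for \<open>half_order B\<close> and C for the number of components of the union of all glued
  colors m i, so that \<open>card \<pi>\<close> \<le> C \<le> the sum of the
  \<open>num_components (H b)\<close>. The triangle inequality, summed over the colors, yields E
  \<le> D * (\<open>card \<pi>\<close> - C) as soon as the faces between the m i and s number at
  least k + (D - 1) * C. The choice s = m 1 achieves this, but the bound is only E \<le> 0 when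
  \<open>card \<pi>\<close> = C. Hence one bonus face is required whenever C < k. If C = k, a
  partition with fewer than k blocks has \<open>card \<pi>\<close> < C and the bound is already
  strict. When m 1 gives no bonus, a transposition costs at most one face in color 1 and wins one in
  each of the D - 1 other colors: a net gain of D - 2, which would be nothing for two
  colors.\<close>

definition conn :: "('a \<times> 'a) set \<Rightarrow> ('a \<times> 'a) set" where
  "conn r = (r \<union> r\<inverse>)\<^sup>*"

text \<open>Connection is a relation on the whole type, as in \<open>graph_components\<close>, so
  that no carrier has to be carried along; only the points whose classes are counted are restricted
  to \<open>X\<close>.\<close>

definition ncomp :: "'a set \<Rightarrow> ('a \<times> 'a) set \<Rightarrow> nat" where
  "ncomp X r = card (X // conn r)"

lemma equiv_conn: "equiv UNIV (conn r)"
  unfolding conn_def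
  by (intro equivI refl_rtrancl sym_rtrancl trans_rtrancl) (auto simp: sym_def)

lemma conn_refl [simp]: "(x, x) \<in> conn r"
  by (simp add: conn_def)

lemma conn_sym: "(x, y) \<in> conn r \<Longrightarrow> (y, x) \<in> conn r"
  using equiv_conn[of r] by (auto simp: equiv_def dest: symD)

lemma conn_trans: "(x, y) \<in> conn r \<Longrightarrow> (y, z) \<in> conn r \<Longrightarrow> (x, z) \<in> conn r"
  by (auto simp: conn_def)

lemma conn_base: "(x, y) \<in> r \<Longrightarrow> (x, y) \<in> conn r"
  by (auto simp: conn_def)

text \<open>Induction along a path. It is also the way to refute connection: exhibit a set that no
  edge enters or leaves.\<close>

lemma conn_closed:
  assumes "(x, y) \<in> conn r" "x \<in> Z" "\<And>a b. (a, b) \<in> r \<Longrightarrow> a \<in> Z \<longleftrightarrow> b \<in> Z"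
  shows "y \<in> Z"
  using assms(1) unfolding conn_def
  by (induction rule: rtrancl_induct) (use assms in auto)

lemma conn_map:
  assumes "(x, y) \<in> conn r" "\<And>a b. (a, b) \<in> r \<Longrightarrow> (f a, f b) \<in> conn s"
  shows "(f x, f y) \<in> conn s"
proof -
  have "y \<in> {z. (f x, f z) \<in> conn s}"
    by (rule conn_closed[OF assms(1)]) (use assms(2) in \<open>auto, (meson conn_sym conn_trans)+\<close>)
  then show ?thesis by simp
qed

lemma conn_subset: "r \<subseteq> conn s \<Longrightarrow> conn r \<subseteq> conn s"
  using conn_map[of _ _ r "\<lambda>x. x" s] by auto

lemma conn_mono: "r \<subseteq> s \<Longrightarrow> conn r \<subseteq> conn s"
  by (rule conn_subset) (auto intro: conn_base)

lemma finite_components: "finite X \<Longrightarrow> finite (X // conn r)"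
  by (simp add: quotient_def)

text \<open>Since \<open>\<phi> b\<close> sends edges into classes of \<open>s\<close>, the image of
  a class of \<open>r b\<close> lies in one class of \<open>s\<close>, and these classes cover
  \<open>X // conn s\<close>. This serves both to compare relations on one set and to count the
  components of a graph glued from pieces.\<close>

lemma ncomp_le_sum:
  assumes "finite P" "\<And>b. b \<in> P \<Longrightarrow> finite (Y b)" "X \<subseteq> (\<Union>b\<in>P. \<phi> b ` Y b)"
    and "\<And>b x y. b \<in> P \<Longrightarrow> (x, y) \<in> r b \<Longrightarrow> (\<phi> b x, \<phi> b y) \<in> conn s"
  shows "ncomp X s \<le> (\<Sum>b\<in>P. ncomp (Y b) (r b))"
proof -
  have sub: "X // conn s \<subseteq> (\<Union>b\<in>P. (\<lambda>c. conn s `` (\<phi> b ` c)) ` (Y b // conn (r b)))"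
  proof
    fix c assume "c \<in> X // conn s"
    then obtain x where x: "x \<in> X" "c = conn s `` {x}" by (auto simp: quotient_def)
    then obtain b y where b: "b \<in> P" "y \<in> Y b" "x = \<phi> b y" using assms(3) by auto
    have "conn s `` (\<phi> b ` (conn (r b) `` {y})) = conn s `` {\<phi> b y}"
      using conn_map[of y _ "r b" "\<phi> b" s] assms(4)[OF b(1)] by (auto intro: conn_trans)
    then show "c \<in> (\<Union>b\<in>P. (\<lambda>c. conn s `` (\<phi> b ` c)) ` (Y b // conn (r b)))"
      using x b by (intro UN_I[of b] image_eqI[of _ _ "conn (r b) `` {y}"] quotientI) auto
  qed
  have "ncomp X s \<le> card (\<Union>b\<in>P. (\<lambda>c. conn s `` (\<phi> b ` c)) ` (Y b // conn (r b)))"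
    unfolding ncomp_def using assms(1,2) sub
    by (intro card_mono finite_UN_I finite_imageI finite_components) auto
  also have "\<dots> \<le> (\<Sum>b\<in>P. card ((\<lambda>c. conn s `` (\<phi> b ` c)) ` (Y b // conn (r b))))"
    using assms(1) by (rule card_UN_le)
  also have "\<dots> \<le> (\<Sum>b\<in>P. ncomp (Y b) (r b))"
    unfolding ncomp_def using assms(2) by (intro sum_mono card_image_le finite_components)
  finally show ?thesis .
qed

lemma ncomp_antimono:
  assumes "finite X" "r \<subseteq> conn s"
  shows "ncomp X s \<le> ncomp X r"
  using ncomp_le_sum[of "{()}" "\<lambda>_. X" X "\<lambda>_ x. x" "\<lambda>_. r" s] assms by auto

lemma ncomp_insert_connected:
  assumes "(x, y) \<in> conn r"
  shows "ncomp X (insert (x, y) r) = ncomp X r"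
proof -
  have "conn (insert (x, y) r) = conn r"
    using assms by (intro equalityI conn_subset conn_mono) (auto intro: conn_base)
  then show ?thesis by (simp add: ncomp_def)
qed

text \<open>Cut a path before its first and after its last use of the new edge: \<open>r\<close>
  alone joins each end of the path to \<open>x\<close> or \<open>y\<close>.\<close>

lemma conn_insert:
  "(a, b) \<in> conn (insert (x, y) r) \<longleftrightarrow> (a, b) \<in> conn r \<or>
     ((a, x) \<in> conn r \<or> (a, y) \<in> conn r) \<and> ((b, x) \<in> conn r \<or> (b, y) \<in> conn r)" (is "?L \<longleftrightarrow> ?R")
proof
  assume ?L
  have "b \<in> {b. (a, b) \<in> conn r \<or>
      ((a, x) \<in> conn r \<or> (a, y) \<in> conn r) \<and> ((b, x) \<in> conn r \<or> (b, y) \<in> conn r)}" (is "_ \<in> ?Z")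
  proof (rule conn_closed[OF \<open>?L\<close>])
    fix c d assume "(c, d) \<in> insert (x, y) r"
    then consider "c = x" "d = y" | "(c, d) \<in> conn r" by (auto intro: conn_base)
    then show "c \<in> ?Z \<longleftrightarrow> d \<in> ?Z"
    proof cases
      case 2
      then have "\<And>z. (c, z) \<in> conn r \<longleftrightarrow> (d, z) \<in> conn r" "\<And>z. (z, c) \<in> conn r \<longleftrightarrow> (z, d) \<in> conn r"
        by (meson conn_sym conn_trans)+
      then show ?thesis by simp
    qed auto
  qed simp
  then show ?R by simp
next
  assume ?R
  have m: "conn r \<subseteq> conn (insert (x, y) r)" by (rule conn_mono) auto
  moreover have "(x, y) \<in> conn (insert (x, y) r)" by (simp add: conn_base)
  ultimately show ?L using \<open>?R\<close> by (meson conn_sym conn_trans subsetD)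
qed

text \<open>The new edge fuses the classes of \<open>x\<close> and \<open>y\<close> and leaves every
  other class as it was.\<close>

lemma ncomp_insert_disconnected:
  assumes "finite X" "x \<in> X" "y \<in> X" "(x, y) \<notin> conn r"
  shows "ncomp X r = Suc (ncomp X (insert (x, y) r))"
proof -
  let ?c = "\<lambda>z. conn r `` {z}" and ?s = "insert (x, y) r"
  have cls: "conn ?s `` {z} = (if z \<in> ?c x \<union> ?c y then ?c x \<union> ?c y else ?c z)" for z
  proof -
    have s: "(a, x) \<in> conn r \<longleftrightarrow> (x, a) \<in> conn r" "(a, y) \<in> conn r \<longleftrightarrow> (y, a) \<in> conn r" for a
      by (auto intro: conn_sym)
    have t: "(z, a) \<in> conn r \<longleftrightarrow> (b, a) \<in> conn r" if "(b, z) \<in> conn r" for a b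
      using that by (meson conn_sym conn_trans)
    show ?thesis
      using t[of x] t[of y] by (auto simp: conn_insert s)
  qed
  have ne: "?c x \<noteq> ?c y" using assms(4) by auto
  have in_c: "z \<in> ?c a \<longleftrightarrow> ?c z = ?c a" for z a
    using eq_equiv_class_iff[OF equiv_conn, of z a r] by (auto intro: conn_sym)
  have "X // conn ?s = insert (?c x \<union> ?c y) (X // conn r - {?c x, ?c y})"
  proof (intro equalityI subsetI)
    fix c assume "c \<in> X // conn ?s"
    then obtain z where z: "z \<in> X" "c = conn ?s `` {z}" by (auto simp: quotient_def)
    show "c \<in> insert (?c x \<union> ?c y) (X // conn r - {?c x, ?c y})"
    proof (cases "z \<in> ?c x \<union> ?c y")
      case False
      then have "c = ?c z" "?c z \<noteq> ?c x" "?c z \<noteq> ?c y"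
        using z(2) cls[of z] in_c[of z x] in_c[of z y] by (simp_all del: Image_singleton_iff)
      then show ?thesis using z(1) by (auto simp: quotient_def)
    qed (simp add: z cls)
  next
    fix c assume "c \<in> insert (?c x \<union> ?c y) (X // conn r - {?c x, ?c y})"
    then consider "c = ?c x \<union> ?c y" | z where "z \<in> X" "c = ?c z" "?c z \<noteq> ?c x" "?c z \<noteq> ?c y"
      by (auto simp: quotient_def)
    then show "c \<in> X // conn ?s"
    proof cases
      case 1
      then have "c = conn ?s `` {x}" using cls[of x] by simp
      then show ?thesis using assms(2) by (auto simp: quotient_def)
    next
      case (2 z)
      then have "c = conn ?s `` {z}" using cls[of z] in_c[of z x] in_c[of z y] by (simp del: Image_singleton_iff)
      then show ?thesis using \<open>z \<in> X\<close> by (auto simp: quotient_def)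
    qed
  qed
  moreover have "?c x \<union> ?c y \<notin> X // conn r"
  proof
    assume "?c x \<union> ?c y \<in> X // conn r"
    then obtain z where "?c x \<union> ?c y = ?c z" by (auto simp: quotient_def)
    moreover have "x \<in> ?c x" "y \<in> ?c y" by simp_all
    ultimately have "x \<in> ?c z" "y \<in> ?c z" by blast+
    then show False using ne in_c[of x z] in_c[of y z] by (simp del: Image_singleton_iff)
  qed
  moreover have sub: "{?c x, ?c y} \<subseteq> X // conn r"
    using assms(2,3) by (auto intro: quotientI)
  moreover have "card {?c x, ?c y} = 2" using ne by simp
  moreover have "card (X // conn r - {?c x, ?c y}) = card (X // conn r) - card {?c x, ?c y}"
    using sub by (intro card_Diff_subset) auto
  moreover have "card {?c x, ?c y} \<le> card (X // conn r)"
    using sub by (rule card_mono[OF finite_components[OF assms(1)]])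
  ultimately show ?thesis
    using finite_components[OF assms(1), of r] by (simp add: ncomp_def)
qed

lemma ncomp_insert_ge:
  assumes "finite X" "x \<in> X" "y \<in> X"
  shows "ncomp X r \<le> Suc (ncomp X (insert (x, y) r))"
  using ncomp_insert_connected[of x y r X] ncomp_insert_disconnected[OF assms, of r]
  by (cases "(x, y) \<in> conn r") auto

text \<open>Induction on \<open>s\<close>, edge by edge: an edge that joins two classes of the
  larger relation \<open>r \<union> t \<union> s\<close> also joins two classes of
  \<open>t \<union> s\<close>, so the left side drops whenever the right side does.\<close>

lemma ncomp_submodular:
  assumes "finite X" "finite s" "s \<subseteq> X \<times> X"
  shows "ncomp X (r \<union> t) + ncomp X (t \<union> s) \<le> ncomp X (r \<union> t \<union> s) + ncomp X t"
  using assms(2,3)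
proof (induction s rule: finite_induct)
  case (insert e s)
  obtain x y where e: "e = (x, y)" "x \<in> X" "y \<in> X" using insert.prems by auto
  have IH: "ncomp X (r \<union> t) + ncomp X (t \<union> s) \<le> ncomp X (r \<union> t \<union> s) + ncomp X t"
    using insert by auto
  show ?case
  proof (cases "(x, y) \<in> conn (t \<union> s)")
    case True
    moreover from this have "(x, y) \<in> conn (r \<union> t \<union> s)"
      using conn_mono[of "t \<union> s" "r \<union> t \<union> s"] by auto
    ultimately show ?thesis using IH by (simp add: e ncomp_insert_connected)
  next
    case False
    then show ?thesis
      using IH ncomp_insert_disconnected[OF assms(1) e(2,3) False]
        ncomp_insert_ge[OF assms(1) e(2,3), of "r \<union> t \<union> s"] by (simp add: e)
  qed
qed simp

lemma ncomp_empty: "ncomp X {} = card X"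
proof -
  have "X // conn {} = (\<lambda>x. {x}) ` X" by (auto simp: conn_def quotient_def)
  then show ?thesis by (simp add: ncomp_def card_image)
qed

lemma card_le_ncomp_plus_card:
  assumes "finite X" "finite s" "s \<subseteq> X \<times> X"
  shows "card X \<le> ncomp X s + card s"
  using assms(2,3)
proof (induction s rule: finite_induct)
  case (insert e s)
  then show ?case using ncomp_insert_ge[OF assms(1), of "fst e" "snd e" s] by auto
qed (simp add: ncomp_empty)

text \<open>No edge leaves a block, so a block contains the whole class of each of its points. One
  chosen point per block gives pairwise distinct classes.\<close>

lemma card_partition_le_ncomp:
  assumes "finite X" "partition_on X P" "\<And>b x y. b \<in> P \<Longrightarrow> (x, y) \<in> r \<Longrightarrow> x \<in> b \<longleftrightarrow> y \<in> b"
  shows "card P \<le> ncomp X r"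
proof -
  define x where "x b = (SOME x. x \<in> b)" for b :: "'a set"
  have x: "x b \<in> b" if "b \<in> P" for b
    using that assms(2) unfolding x_def partition_on_def by (metis some_in_eq)
  have sub: "conn r `` {x b} \<subseteq> b" if "b \<in> P" for b
    using conn_closed[of "x b" _ r b, OF _ x[OF that] assms(3)[OF that]] by blast
  have "inj_on (\<lambda>b. conn r `` {x b}) P"
  proof (rule inj_onI)
    fix b c assume bc: "b \<in> P" "c \<in> P" "conn r `` {x b} = conn r `` {x c}"
    have "x b \<in> conn r `` {x c}" using bc(3)[symmetric] by simp
    then have "x b \<in> b \<inter> c" using sub[of c] x[of b] bc by blast
    then show "b = c" using bc assms(2) by (auto simp: partition_on_def disjoint_def)
  qed
  moreover have "(\<lambda>b. conn r `` {x b}) ` P \<subseteq> X // conn r"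
    using x assms(2) by (auto simp: quotient_def partition_on_def)
  ultimately show ?thesis
    unfolding ncomp_def by (intro card_inj_on_le finite_components assms(1))
qed

section \<open>Perfect matchings and the faces formed by two of them\<close>

definition perfect_matching :: "'w set \<Rightarrow> 'b set \<Rightarrow> ('w \<times> 'b) set \<Rightarrow> bool" where
  "perfect_matching V W m \<longleftrightarrow> m \<subseteq> V \<times> W \<and>
     (\<forall>v\<in>V. \<exists>!w. (v, w) \<in> m) \<and> (\<forall>w\<in>W. \<exists>!v. (v, w) \<in> m)"

definition sum_edges :: "('w \<times> 'b) set \<Rightarrow> (('w + 'b) \<times> ('w + 'b)) set" where
  "sum_edges m = map_prod Inl Inr ` m"

lemma sum_edges_UN: "sum_edges (\<Union>i\<in>I. m i) = (\<Union>i\<in>I. sum_edges (m i))"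
  by (auto simp: sum_edges_def)

lemma sum_edges_subset: "m \<subseteq> V \<times> W \<Longrightarrow> sum_edges m \<subseteq> (V <+> W) \<times> (V <+> W)"
  by (auto simp: sum_edges_def)

lemma mem_sum_edges: "(x, y) \<in> sum_edges m \<longleftrightarrow> (\<exists>v w. x = Inl v \<and> y = Inr w \<and> (v, w) \<in> m)"
  by (auto simp: sum_edges_def)

lemma perfect_matching_bij:
  assumes "bij_betw f V W"
  shows "perfect_matching V W {(v, f v) | v. v \<in> V}"
  using assms unfolding perfect_matching_def bij_betw_def inj_on_def by blast

lemma perfect_matchingE:
  assumes "perfect_matching V W m"
  obtains f where "bij_betw f V W" "m = {(v, f v) | v. v \<in> V}"
proof
  define f where "f v = (THE w. (v, w) \<in> m)" for v
  have f: "(v, w) \<in> m \<longleftrightarrow> v \<in> V \<and> w = f v" for v w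
  proof
    assume vw: "(v, w) \<in> m"
    then have "v \<in> V" "\<exists>!w. (v, w) \<in> m" using assms by (auto simp: perfect_matching_def)
    then show "v \<in> V \<and> w = f v" using vw by (auto simp: f_def the1_equality)
  next
    assume vw: "v \<in> V \<and> w = f v"
    then have "\<exists>!w. (v, w) \<in> m" using assms by (auto simp: perfect_matching_def)
    from theI'[OF this] show "(v, w) \<in> m" using vw by (simp add: f_def)
  qed
  then show "m = {(v, f v) | v. v \<in> V}" by auto
  show "bij_betw f V W"
  proof (rule bij_betw_imageI)
    show "inj_on f V"
    proof (rule inj_onI)
      fix x y assume xy: "x \<in> V" "y \<in> V" "f x = f y"
      then have "(x, f x) \<in> m" "(y, f x) \<in> m" using f by simp_all
      moreover from this have "f x \<in> W" using assms by (auto simp: perfect_matching_def)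
      ultimately show "x = y" using assms unfolding perfect_matching_def by blast
    qed
    show "f ` V = W"
    proof
      show "f ` V \<subseteq> W"
      proof
        fix w assume "w \<in> f ` V"
        then obtain v where "(v, w) \<in> m" using f by auto
        then show "w \<in> W" using assms by (auto simp: perfect_matching_def)
      qed
      show "W \<subseteq> f ` V"
      proof
        fix w assume "w \<in> W"
        then obtain v where "(v, w) \<in> m" using assms unfolding perfect_matching_def by blast
        then show "w \<in> f ` V" using f by auto
      qed
    qed
  qed
qed

lemma card_perfect_matching:
  assumes "perfect_matching V W m"
  shows "card m = card V"
proof -
  obtain f where "bij_betw f V W" and f: "m = {(v, f v) | v. v \<in> V}"
    by (rule perfect_matchingE[OF assms])
  have "m = (\<lambda>v. (v, f v)) ` V" unfolding f by auto
  then show ?thesis by (simp add: card_image inj_on_def)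
qed

text \<open>Every class meets \<open>V\<close>, because \<open>m\<close> joins each black vertex to
  a white one.\<close>

lemma ncomp_matching_le:
  assumes "finite V" "perfect_matching V W m" "sum_edges m \<subseteq> r"
  shows "ncomp (V <+> W) r \<le> card V"
proof -
  have "(V <+> W) // conn r \<subseteq> (\<lambda>v. conn r `` {Inl v}) ` V"
  proof
    fix c assume "c \<in> (V <+> W) // conn r"
    then obtain x where x: "x \<in> V <+> W" "c = conn r `` {x}" by (auto simp: quotient_def)
    have "\<exists>v\<in>V. (Inl v, x) \<in> conn r"
    proof (cases x)
      case (Inr w)
      then have "w \<in> W" using x(1) by auto
      then obtain v where v: "(v, w) \<in> m" using assms(2) unfolding perfect_matching_def by blast
      then have "v \<in> V" using assms(2) by (auto simp: perfect_matching_def)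
      moreover have "(Inl v, x) \<in> sum_edges m" using v Inr by (simp add: mem_sum_edges)
      ultimately show ?thesis using conn_base[OF subsetD[OF assms(3)]] by metis
    next
      case (Inl v)
      then have "v \<in> V" using x(1) by auto
      then show ?thesis using Inl by (intro bexI[of _ v]) simp_all
    qed
    then obtain v where "v \<in> V" "(Inl v, x) \<in> conn r" by blast
    then show "c \<in> (\<lambda>v. conn r `` {Inl v}) ` V"
      using x(2) equiv_class_eq[OF equiv_conn, of "Inl v" x r] by (intro image_eqI[of _ _ v]) simp_all
  qed
  then show ?thesis unfolding ncomp_def
    by (meson assms(1) card_image_le card_mono finite_imageI le_trans)
qed

lemma ncomp_perfect_matching:
  assumes "finite V" "finite W" "card V = card W" "perfect_matching V W m"
  shows "ncomp (V <+> W) (sum_edges m) = card V"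
proof (rule antisym)
  show "ncomp (V <+> W) (sum_edges m) \<le> card V" using assms by (intro ncomp_matching_le) auto
  have m: "m \<subseteq> V \<times> W" using assms by (simp add: perfect_matching_def)
  have "card (sum_edges m) \<le> card m" unfolding sum_edges_def
    using m assms(1,2) by (meson card_image_le finite_SigmaI finite_subset)
  \<comment> \<open>Each of the \<open>card V\<close> edges fuses at most two of the initially
    \<open>2 * card V\<close> classes.\<close>
  then show "card V \<le> ncomp (V <+> W) (sum_edges m)"
    using card_le_ncomp_plus_card[OF _ _ sum_edges_subset[OF m]] assms card_perfect_matching[OF assms(4)]
      finite_subset[OF sum_edges_subset[OF m]] by (simp add: card_Plus)
qed

text \<open>Submodularity around \<open>sum_edges m\<close>, which has at most \<open>card V\<close>
  classes; omitting \<open>m\<close> from the triple union can only add classes. For perfect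
  matchings, \<open>card V\<close> minus the number of faces is the Cayley distance of the
  corresponding permutations.\<close>

lemma ncomp_matching_triangle:
  assumes "finite V" "finite W" "perfect_matching V W m" "perfect_matching V W s"
  shows "ncomp (V <+> W) (sum_edges r \<union> sum_edges m) + ncomp (V <+> W) (sum_edges m \<union> sum_edges s)
    \<le> ncomp (V <+> W) (sum_edges r \<union> sum_edges s) + card V"
proof -
  have s: "sum_edges s \<subseteq> (V <+> W) \<times> (V <+> W)"
    using assms(4) by (intro sum_edges_subset) (simp add: perfect_matching_def)
  have "ncomp (V <+> W) (sum_edges r \<union> sum_edges m) + ncomp (V <+> W) (sum_edges m \<union> sum_edges s)
      \<le> ncomp (V <+> W) (sum_edges r \<union> sum_edges m \<union> sum_edges s) + ncomp (V <+> W) (sum_edges m)"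
    using assms s by (intro ncomp_submodular) (auto intro: finite_subset[OF s])
  moreover have "ncomp (V <+> W) (sum_edges r \<union> sum_edges m \<union> sum_edges s)
      \<le> ncomp (V <+> W) (sum_edges r \<union> sum_edges s)"
    using assms by (intro ncomp_antimono) (auto intro: conn_base)
  moreover have "ncomp (V <+> W) (sum_edges m) \<le> card V"
    using assms by (intro ncomp_matching_le) auto
  ultimately show ?thesis by linarith
qed

text \<open>Here \<open>p\<close> is the permutation \<open>g\<inverse> \<circ> f\<close> of the
  white vertices. Being injective, it maps the finite set \<open>A\<close> onto itself, so no edge
  of either matching leaves \<open>A\<close> together with its \<open>g\<close>-partners.\<close>

lemma two_matchings_closed:
  assumes "inj_on f V" "inj_on g V" "finite A" "A \<subseteq> V" "p ` A \<subseteq> A" "\<And>x. x \<in> V \<Longrightarrow> p x \<in> V"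
    and gp: "\<And>x. x \<in> V \<Longrightarrow> g (p x) = f x"
    and xy: "(x, y) \<in> sum_edges {(v, g v) | v. v \<in> V} \<union> sum_edges {(v, f v) | v. v \<in> V}"
  shows "x \<in> Inl ` A \<union> Inr ` g ` A \<longleftrightarrow> y \<in> Inl ` A \<union> Inr ` g ` A"
proof -
  have "inj_on p V" using assms(1) gp by (metis inj_on_def)
  then have pA: "p ` A = A" using assms(3,4,5) endo_inj_surj inj_on_subset by metis
  have g: "g v \<in> g ` A \<longleftrightarrow> v \<in> A" if "v \<in> V" for v
    using that assms(2,4) by (meson inj_on_image_mem_iff)
  have "f v \<in> g ` A \<longleftrightarrow> v \<in> A" if "v \<in> V" for v
  proof -
    have "f v \<in> g ` A \<longleftrightarrow> p v \<in> A" using g[of "p v"] gp[OF that] assms(6)[OF that] by simp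
    also have "\<dots> \<longleftrightarrow> v \<in> A"
      using pA \<open>inj_on p V\<close> that assms(4) by (metis inj_on_image_mem_iff)
    finally show ?thesis .
  qed
  then show ?thesis using xy g by (auto simp: mem_sum_edges)
qed

text \<open>
  The face of colors \<open>f\<close> and \<open>g\<close> through \<open>u\<close> and \<open>v\<close> is a cycle of the permutation
  \<open>g\<inverse> \<circ> f\<close>, and composing with the transposition of \<open>u\<close> and \<open>v\<close> cuts it in two.
\<close>

lemma swap_disconnects:
  assumes "finite V" "bij_betw f V W" "bij_betw g V W" "u \<in> V" "v \<in> V" "u \<noteq> v"
    and uv: "(Inl u, Inl v) \<in> conn (sum_edges {(x, g x) | x. x \<in> V} \<union> sum_edges {(x, f x) | x. x \<in> V})"
  shows "(Inl v, Inl u) \<notin>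
    conn (sum_edges {(x, g x) | x. x \<in> V} \<union> sum_edges {(x, (f(u := f v, v := f u)) x) | x. x \<in> V})"
proof -
  let ?f' = "f(u := f v, v := f u)"
  define p where "p x = inv_into V g (f x)" for x
  define q where "q x = inv_into V g (?f' x)" for x
  have inj: "inj_on f V" "inj_on g V" using assms by (auto simp: bij_betw_def)
  have inj': "inj_on ?f' V" using inj(1) assms(4-6) by (auto simp: inj_on_def)
  have img: "f x \<in> g ` V" "?f' x \<in> g ` V" if "x \<in> V" for x
    using that assms(2-5) by (auto simp: bij_betw_def)
  have p: "p x \<in> V" "g (p x) = f x" if "x \<in> V" for x
    unfolding p_def using img(1)[OF that] by (rule inv_into_into, rule f_inv_into_f)
  have q: "q x \<in> V" "g (q x) = ?f' x" if "x \<in> V" for x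
    unfolding q_def using img(2)[OF that] by (rule inv_into_into, rule f_inv_into_f)
  have pn: "(p ^^ n) u \<in> V" for n by (induction n) (use p assms in auto)
  \<comment> \<open>The orbit of \<open>u\<close> with its black partners is closed under both
    matchings, so it contains \<open>v\<close>, which is connected to \<open>u\<close>.\<close>
  let ?A = "range (\<lambda>n. (p ^^ n) u)"
  have A: "?A \<subseteq> V" using pn by auto
  have pA: "p ` ?A \<subseteq> ?A"
  proof
    fix z assume "z \<in> p ` ?A"
    then obtain n where "z = (p ^^ Suc n) u" by auto
    then show "z \<in> ?A" by blast
  qed
  have "Inl v \<in> Inl ` ?A \<union> Inr ` g ` ?A"
  proof (rule conn_closed[OF uv])
    show "Inl u \<in> Inl ` ?A \<union> Inr ` g ` ?A" using rangeI[of "\<lambda>n. (p ^^ n) u" 0] by auto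
  qed (rule two_matchings_closed[OF inj finite_subset[OF A assms(1)] A pA p])
  then have ex: "\<exists>n. (p ^^ n) u = v" by auto
  define n where "n = (LEAST n. (p ^^ n) u = v)"
  have n: "(p ^^ n) u = v" unfolding n_def using ex by (rule LeastI_ex)
  have least: "(p ^^ j) u \<noteq> v" if "j < n" for j using that not_less_Least unfolding n_def by blast
  \<comment> \<open>The arc of the cycle after \<open>u\<close>, up to and including the first
    arrival at \<open>v\<close>. As \<open>q\<close> is \<open>p\<close> with the images of
    \<open>u\<close> and \<open>v\<close> exchanged, it sends \<open>v\<close> back to
    \<open>p u\<close> and keeps the arc invariant. The arc avoids \<open>u\<close>: a return to
    \<open>u\<close> after \<open>j\<close> steps would make \<open>v\<close> appear already after
    \<open>n - j\<close> steps.\<close>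
  let ?A' = "(\<lambda>j. (p ^^ j) u) ` {1..n}"
  have "u \<notin> ?A'"
  proof
    assume "u \<in> ?A'"
    then obtain j where j: "1 \<le> j" "j \<le> n" "(p ^^ j) u = u" by auto
    have "(p ^^ (n - j + j)) u = (p ^^ (n - j)) u" unfolding funpow_add using j by simp
    then show False using least[of "n - j"] j n by simp
  qed
  have "n \<ge> 1" using n assms(6) by (cases n) auto
  have "v \<in> ?A'" using n \<open>n \<ge> 1\<close> by (auto intro!: image_eqI[of _ _ n])
  have qx: "q x = (if x = u then p v else if x = v then p u else p x)" for x
    by (auto simp: p_def q_def)
  have qA: "q ` ?A' \<subseteq> ?A'"
  proof
    fix z assume "z \<in> q ` ?A'"
    then obtain j where j: "1 \<le> j" "j \<le> n" "z = q ((p ^^ j) u)" by auto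
    have neq: "(p ^^ j) u \<noteq> u" using \<open>u \<notin> ?A'\<close> j by force
    show "z \<in> ?A'"
    proof (cases "j = n")
      case True
      then have "z = (p ^^ 1) u" using j n assms(6) by (simp add: qx)
      then show ?thesis using \<open>n \<ge> 1\<close> by (intro image_eqI[of _ _ 1]) auto
    next
      case False
      then have "z = (p ^^ Suc j) u" using j least[of j] neq by (simp add: qx)
      moreover have "Suc j \<in> {1..n}" using False j by simp
      ultimately show ?thesis by (rule image_eqI)
    qed
  qed
  have A': "?A' \<subseteq> V" using pn by auto
  show ?thesis
  proof
    assume "(Inl v, Inl u) \<in>
      conn (sum_edges {(x, g x) | x. x \<in> V} \<union> sum_edges {(x, ?f' x) | x. x \<in> V})"
    then have "Inl u \<in> Inl ` ?A' \<union> Inr ` g ` ?A'"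
      by (rule conn_closed)
        (use \<open>v \<in> ?A'\<close> in simp, rule two_matchings_closed[OF inj' inj(2) _ A' qA q], auto)
    then show False using \<open>u \<notin> ?A'\<close> by auto
  qed
qed


text \<open>
  Take \<open>s = m 1\<close>, except when every face of colors \<open>1i\<close> exhausts a connected component: then a
  transposition applied to \<open>m 1\<close> loses one face of color \<open>1\<close> and gains one for each of the other
  \<open>D - 1 \<ge> 2\<close> colors.
\<close>

lemma exists_good_matching:
  fixes V :: "'w set" and W :: "'b set" and m :: "nat \<Rightarrow> ('w \<times> 'b) set"
  assumes fin: "finite V" "finite W" "card V = card W" and "D \<ge> 3"
    and m: "\<And>i. i \<in> {1..D} \<Longrightarrow> perfect_matching V W (m i)"
  defines "C \<equiv> ncomp (V <+> W) (\<Union>i\<in>{1..D}. sum_edges (m i))"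
  obtains s where "perfect_matching V W s"
    "(\<Sum>i = 1..D. ncomp (V <+> W) (sum_edges (m i) \<union> sum_edges s)) \<ge>
      card V + (D - 1) * C + (if C < card V then 1 else 0)"
proof -
  let ?X = "V <+> W" and ?all = "\<Union>i\<in>{1..D}. sum_edges (m i)"
  let ?n = "\<lambda>i s. ncomp ?X (sum_edges (m i) \<union> sum_edges s)"
  have finX: "finite ?X" using fin by simp
  have one: "1 \<in> {1..D}" using \<open>D \<ge> 3\<close> by simp
  have split: "(\<Sum>i = 1..D. h i) = h 1 + (\<Sum>i = 2..D. h i)" for h :: "nat \<Rightarrow> nat"
    using \<open>D \<ge> 3\<close> sum.atLeast_Suc_atMost[of 1 D h] by (simp add: numeral_2_eq_2)
  have n11: "?n 1 (m 1) = card V" using ncomp_perfect_matching[OF fin m[OF one]] by simp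
  have all: "sum_edges (m i) \<subseteq> conn ?all" if "i \<in> {1..D}" for i
    using that by (intro subrelI conn_base UN_I)
  have ge: "C \<le> ?n i (m 1)" if "i \<in> {2..D}" for i
    unfolding C_def using all[of i] all[OF one] that by (intro ncomp_antimono finX) simp
  have sum_ge: "(\<Sum>i = 2..D. h i) \<ge> (D - 1) * c" if "\<And>i. i \<in> {2..D} \<Longrightarrow> c \<le> h i" for c :: nat and h
    using sum_bounded_below[of "{2..D}" c h] that by simp
  show thesis
  proof (cases "C < card V \<and> (\<forall>i\<in>{2..D}. ?n i (m 1) = C)")
    case False
    have "(\<Sum>i = 2..D. ?n i (m 1)) \<ge> (D - 1) * C + (if C < card V then 1 else 0)"
    proof (cases "C < card V")
      case True
      then obtain j where j: "j \<in> {2..D}" "?n j (m 1) \<noteq> C" using False by auto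
      have "(\<Sum>i = 2..D. C) < (\<Sum>i = 2..D. ?n i (m 1))"
        using ge j by (intro sum_strict_mono_ex1) (auto intro!: bexI[of _ j] simp: order_less_le)
      then show ?thesis using True by simp
    qed (use sum_ge[of C, OF ge] in simp)
    then have "card V + (D - 1) * C + (if C < card V then 1 else 0) \<le> (\<Sum>i = 1..D. ?n i (m 1))"
      unfolding split n11 by linarith
    then show thesis by (rule that[OF m[OF one]])
  next
    case True
    \<comment> \<open>With fewer components than white vertices, two white vertices share a
      component; these two are transposed.\<close>
    have "\<not> inj_on (\<lambda>v. conn ?all `` {Inl v}) V"
    proof
      assume "inj_on (\<lambda>v. conn ?all `` {Inl v}) V"
      then have "card V \<le> C" unfolding C_def ncomp_def
        by (rule card_inj_on_le) (auto intro: quotientI finite_components finX)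
      then show False using True by simp
    qed
    then obtain u v where uv: "u \<in> V" "v \<in> V" "u \<noteq> v" and eq: "conn ?all `` {Inl u} = conn ?all `` {Inl v}"
      unfolding inj_on_def by blast
    have uv_all: "(Inl u, Inl v) \<in> conn ?all"
      using eq_equiv_class[OF eq equiv_conn] by simp
    have XX: "Inl u \<in> ?X" "Inl v \<in> ?X" using uv by auto
    obtain f where f: "bij_betw f V W" "m 1 = {(x, f x) | x. x \<in> V}"
      by (rule perfect_matchingE[OF m[OF one]])
    let ?f = "f(u := f v, v := f u)"
    define s where "s = {(x, ?f x) | x. x \<in> V}"
    have "bij_betw ?f V W"
    proof (rule bij_betw_imageI)
      show "inj_on ?f V" using f(1) uv by (auto simp: bij_betw_def inj_on_def)
      show "?f ` V = W" using f(1) uv by (force simp: bij_betw_def)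
    qed
    then have s: "perfect_matching V W s" unfolding s_def by (rule perfect_matching_bij)
    have edge1: "(Inl x, Inr (f x)) \<in> conn (insert (Inl u, Inl v) (sum_edges (m 1)))"
      if "x \<in> V" for x
      using that by (intro conn_base) (simp add: mem_sum_edges f(2) del: One_nat_def)
    \<comment> \<open>One extra edge between \<open>u\<close> and \<open>v\<close> lets
      \<open>m 1\<close> generate the crossed edges of \<open>s\<close> as well, and one edge costs
      at most one class. This gives \<open>n1\<close>.\<close>
    have s_conn: "sum_edges s \<subseteq> conn (insert (Inl u, Inl v) (sum_edges (m 1)))" (is "_ \<subseteq> conn ?r")
    proof (rule subrelI)
      fix a b assume "(a, b) \<in> sum_edges s"
      then obtain x where x: "x \<in> V" "a = Inl x" "b = Inr (?f x)"
        by (auto simp: mem_sum_edges s_def)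
      have "(Inl u, Inl v) \<in> conn ?r" by (simp add: conn_base)
      then have "(Inl u, Inr (f v)) \<in> conn ?r" "(Inl v, Inr (f u)) \<in> conn ?r"
        using edge1 uv by (meson conn_sym conn_trans)+
      then show "(a, b) \<in> conn ?r" using x edge1 by simp
    qed
    have r_all: "?r \<subseteq> conn ?all" using all[OF one] uv_all by simp
    have n1: "card V \<le> Suc (?n 1 s)"
    proof -
      have "ncomp ?X ?r \<le> ?n 1 s"
        using s_conn by (intro ncomp_antimono finX) (auto intro: conn_base)
      then show ?thesis
        using ncomp_insert_ge[OF finX XX, of "sum_edges (m 1)"] n11 by simp
    qed
    \<comment> \<open>The faces of colors 1 and \<open>i\<close> are as few as the components, so
      \<open>u\<close> and \<open>v\<close> already share a face, and the transposition separates
      them. Joining them again removes exactly one class and stays inside \<open>conn ?all\<close>,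
      hence leaves at least \<open>C\<close> classes.\<close>
    have n2: "Suc C \<le> ?n i s" if i: "i \<in> {2..D}" for i
    proof -
      have iD: "i \<in> {1..D}" using i by simp
      let ?i1 = "sum_edges (m i) \<union> sum_edges (m 1)" and ?is = "sum_edges (m i) \<union> sum_edges s"
      have i1: "(Inl u, Inl v) \<in> conn ?i1"
      proof (rule ccontr)
        assume "(Inl u, Inl v) \<notin> conn ?i1"
        then have "?n i (m 1) = Suc (ncomp ?X (insert (Inl u, Inl v) ?i1))"
          by (rule ncomp_insert_disconnected[OF finX XX])
        moreover have "C \<le> ncomp ?X (insert (Inl u, Inl v) ?i1)"
          unfolding C_def using uv_all all[OF iD] all[OF one] by (intro ncomp_antimono finX) simp
        ultimately show False using True i by simp
      qed
      obtain g where g: "bij_betw g V W" "m i = {(x, g x) | x. x \<in> V}"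
        by (rule perfect_matchingE[OF m[OF iD]])
      have "(Inl v, Inl u) \<notin> conn ?is"
        unfolding g(2) s_def
        by (rule swap_disconnects[OF fin(1) f(1) g(1) uv i1[unfolded f(2) g(2)]])
      then have "(Inl u, Inl v) \<notin> conn ?is" using conn_sym by metis
      then have "?n i s = Suc (ncomp ?X (insert (Inl u, Inl v) ?is))"
        by (rule ncomp_insert_disconnected[OF finX XX])
      moreover have "C \<le> ncomp ?X (insert (Inl u, Inl v) ?is)"
        unfolding C_def
      proof (intro ncomp_antimono finX)
        have "sum_edges s \<subseteq> conn ?all" using s_conn conn_subset[OF r_all] by (rule order_trans)
        then show "insert (Inl u, Inl v) ?is \<subseteq> conn ?all" using uv_all all[OF iD] by simp
      qed
      ultimately show ?thesis by simp
    qed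
    \<comment> \<open>The balance: at most one class is lost in color 1 and \<open>D - 1\<close> are
      gained elsewhere, and \<open>D - 2\<close> is at least the bonus.\<close>
    have "(D - 1) * Suc C \<le> (\<Sum>i = 2..D. ?n i s)" by (rule sum_ge[OF n2])
    moreover have "(D - 1) * Suc C = (D - 1) * C + (D - 1)" by simp
    moreover have "D - 1 \<ge> 2" using \<open>D \<ge> 3\<close> by simp
    moreover have "(if C < card V then 1 else 0) \<le> (1::nat)" by simp
    ultimately have "card V + (D - 1) * C + (if C < card V then 1 else 0) \<le> (\<Sum>i = 1..D. ?n i s)"
      unfolding split using n1 by linarith
    then show thesis by (rule that[OF s])
  qed
qed

section \<open>Counting index assignments\<close>

definition compatible :: "('a \<times> 'a) set \<Rightarrow> ('a \<Rightarrow> 'c) \<Rightarrow> bool" where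
  "compatible r n \<longleftrightarrow> (\<forall>(x, y)\<in>r. n x = n y)"

lemma compatible_conn:
  assumes "compatible r n" "(x, y) \<in> conn r"
  shows "n x = n y"
proof -
  have "y \<in> {z. n x = n z}"
    by (rule conn_closed[OF assms(2)]) (use assms(1) in \<open>auto simp: compatible_def\<close>)
  then show ?thesis by simp
qed

text \<open>A compatible assignment is constant on classes, hence the same thing as a function on
  the quotient.\<close>

lemma card_compatible:
  fixes N :: nat
  assumes "finite X" "r \<subseteq> X \<times> X"
  shows "card {n \<in> X \<rightarrow>\<^sub>E {1..N}. compatible r n} = N ^ ncomp X r"
proof -
  let ?c = "\<lambda>x. conn r `` {x}"
  let ?A = "X // conn r \<rightarrow>\<^sub>E {1..N}" and ?B = "{n \<in> X \<rightarrow>\<^sub>E {1..N}. compatible r n}"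
  have c_eq: "?c x = ?c y" if "(x, y) \<in> conn r" for x y
    using that by (rule equiv_class_eq[OF equiv_conn])
  have "bij_betw (\<lambda>h. \<lambda>x\<in>X. h (?c x)) ?A ?B"
  proof (rule bij_betw_byWitness[where f' = "\<lambda>n. \<lambda>c\<in>X // conn r. n (SOME x. x \<in> X \<and> c = ?c x)"])
    have rep: "(SOME x. x \<in> X \<and> c = ?c x) \<in> X \<and> c = ?c (SOME x. x \<in> X \<and> c = ?c x)"
      if "c \<in> X // conn r" for c
      by (rule someI_ex) (use that in \<open>auto simp: quotient_def\<close>)
    show "\<forall>h\<in>?A. (\<lambda>c\<in>X // conn r. (\<lambda>x\<in>X. h (?c x)) (SOME x. x \<in> X \<and> c = ?c x)) = h"
    proof (intro ballI ext)
      fix h c assume h: "h \<in> ?A"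
      show "(\<lambda>c\<in>X // conn r. (\<lambda>x\<in>X. h (?c x)) (SOME x. x \<in> X \<and> c = ?c x)) c = h c"
        using h rep[of c] by (cases "c \<in> X // conn r") (simp_all add: PiE_arb[OF h])
    qed
    show "\<forall>n\<in>?B. (\<lambda>x\<in>X. (\<lambda>c\<in>X // conn r. n (SOME x. x \<in> X \<and> c = ?c x)) (?c x)) = n"
    proof (intro ballI ext)
      fix n x assume n: "n \<in> ?B"
      then have nE: "n \<in> X \<rightarrow>\<^sub>E {1..N}" by simp
      show "(\<lambda>x\<in>X. (\<lambda>c\<in>X // conn r. n (SOME x. x \<in> X \<and> c = ?c x)) (?c x)) x = n x"
      proof (cases "x \<in> X")
        case True
        then have q: "?c x \<in> X // conn r" by (rule quotientI)
        have "(x, SOME y. y \<in> X \<and> ?c x = ?c y) \<in> conn r"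
          by (rule eq_equiv_class[OF conjunct2[OF rep[OF q]] equiv_conn UNIV_I])
        then have "n x = n (SOME y. y \<in> X \<and> ?c x = ?c y)"
          using n by (intro compatible_conn[of r n]) simp_all
        then show ?thesis using True q by simp
      qed (simp add: PiE_arb[OF nE])
    qed
    show "(\<lambda>h. \<lambda>x\<in>X. h (?c x)) ` ?A \<subseteq> ?B"
    proof (intro image_subsetI CollectI conjI)
      fix h assume h: "h \<in> ?A"
      show "(\<lambda>x\<in>X. h (?c x)) \<in> X \<rightarrow>\<^sub>E {1..N}"
        using PiE_mem[OF h] by (intro restrict_PiE_iff[THEN iffD2] ballI) (auto intro: quotientI)
      show "compatible r (\<lambda>x\<in>X. h (?c x))"
        unfolding compatible_def
      proof (intro ballI, clarify)
        fix x y assume xy: "(x, y) \<in> r"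
        then have "x \<in> X" "y \<in> X" using assms(2) by auto
        then show "(\<lambda>x\<in>X. h (?c x)) x = (\<lambda>x\<in>X. h (?c x)) y"
          using c_eq[OF conn_base[OF xy]] by simp
      qed
    qed
    show "(\<lambda>n. \<lambda>c\<in>X // conn r. n (SOME x. x \<in> X \<and> c = ?c x)) ` ?B \<subseteq> ?A"
    proof (intro image_subsetI restrict_PiE_iff[THEN iffD2] ballI)
      fix n c assume n: "n \<in> ?B" and c: "c \<in> X // conn r"
      then have "n \<in> X \<rightarrow>\<^sub>E {1..N}" by simp
      then show "n (SOME x. x \<in> X \<and> c = ?c x) \<in> {1..N}"
        by (rule PiE_mem) (rule conjunct1[OF rep[OF c]])
    qed
  qed
  then have "card ?B = card ?A" by (simp add: bij_betw_same_card)
  also have "\<dots> = N ^ ncomp X r"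
    by (simp add: card_PiE finite_components[OF assms(1)] ncomp_def)
  finally show ?thesis .
qed

text \<open>Exchanging the two arguments turns one multi-index per vertex into one assignment per
  color. Constraints of different colors are independent, so the counts multiply.\<close>

lemma card_compatible_colors:
  fixes I :: "'i set" and N :: nat
  assumes "finite I" "finite X" "\<And>i. i \<in> I \<Longrightarrow> r i \<subseteq> X \<times> X"
  shows "card {n \<in> X \<rightarrow>\<^sub>E (I \<rightarrow>\<^sub>E {1..N}). \<forall>i\<in>I. compatible (r i) (\<lambda>x. n x i)} =
    N ^ (\<Sum>i\<in>I. ncomp X (r i))"
proof -
  let ?S = "\<lambda>i. {n \<in> X \<rightarrow>\<^sub>E {1..N}. compatible (r i) n}"
  let ?B = "{n \<in> X \<rightarrow>\<^sub>E (I \<rightarrow>\<^sub>E {1..N}). \<forall>i\<in>I. compatible (r i) (\<lambda>x. n x i)}"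
  \<comment> \<open>Restriction resets values outside \<open>X\<close>, and compatibility does not
    notice because all edges stay inside \<open>X\<close>.\<close>
  have cong: "compatible (r i) n \<longleftrightarrow> compatible (r i) n'"
    if "i \<in> I" "\<And>x. x \<in> X \<Longrightarrow> n x = n' x" for n n' :: "'a \<Rightarrow> nat" and i
    unfolding compatible_def using that assms(3)[OF that(1)] by fastforce
  have "bij_betw (\<lambda>n. \<lambda>i\<in>I. \<lambda>x\<in>X. n x i) ?B (PiE I ?S)"
  proof (rule bij_betw_byWitness[where f' = "\<lambda>m. \<lambda>x\<in>X. \<lambda>i\<in>I. m i x"])
    show "\<forall>n\<in>?B. (\<lambda>x\<in>X. \<lambda>i\<in>I. (\<lambda>i\<in>I. \<lambda>x\<in>X. n x i) i x) = n"
    proof (intro ballI ext)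
      fix n x i assume "n \<in> ?B"
      then have n: "n \<in> X \<rightarrow>\<^sub>E (I \<rightarrow>\<^sub>E {1..N})" by simp
      show "(\<lambda>x\<in>X. \<lambda>i\<in>I. (\<lambda>i\<in>I. \<lambda>x\<in>X. n x i) i x) x i = n x i"
        using PiE_arb[OF n, of x] PiE_arb[OF PiE_mem[OF n], of x i]
        by (cases "x \<in> X"; cases "i \<in> I") auto
    qed
    show "\<forall>m\<in>PiE I ?S. (\<lambda>i\<in>I. \<lambda>x\<in>X. (\<lambda>x\<in>X. \<lambda>i\<in>I. m i x) x i) = m"
    proof (intro ballI ext)
      fix m x i assume m: "m \<in> PiE I ?S"
      show "(\<lambda>i\<in>I. \<lambda>x\<in>X. (\<lambda>x\<in>X. \<lambda>i\<in>I. m i x) x i) i x = m i x"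
      proof (cases "i \<in> I")
        case True
        then have mi: "m i \<in> X \<rightarrow>\<^sub>E {1..N}" using PiE_mem[OF m True] by simp
        show ?thesis using True PiE_arb[OF mi, of x] by (cases "x \<in> X") auto
      qed (simp add: PiE_arb[OF m])
    qed
    show "(\<lambda>n. \<lambda>i\<in>I. \<lambda>x\<in>X. n x i) ` ?B \<subseteq> PiE I ?S"
    proof (intro image_subsetI restrict_PiE_iff[THEN iffD2] ballI CollectI conjI)
      fix n i x assume n: "n \<in> ?B" and i: "i \<in> I"
      show "compatible (r i) (\<lambda>x\<in>X. n x i)"
        using n cong[OF i, of "\<lambda>x\<in>X. n x i" "\<lambda>x. n x i"] i by simp
      assume "x \<in> X"
      moreover have "n \<in> X \<rightarrow>\<^sub>E (I \<rightarrow>\<^sub>E {1..N})" using n by simp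
      ultimately have "n x \<in> I \<rightarrow>\<^sub>E {1..N}" by (rule PiE_mem[rotated])
      then show "n x i \<in> {1..N}" using i by (rule PiE_mem)
    qed
    show "(\<lambda>m. \<lambda>x\<in>X. \<lambda>i\<in>I. m i x) ` PiE I ?S \<subseteq> ?B"
    proof (intro image_subsetI CollectI conjI ballI restrict_PiE_iff[THEN iffD2])
      fix m x i assume m: "m \<in> PiE I ?S" and i: "i \<in> I"
      show "compatible (r i) (\<lambda>x. (\<lambda>x\<in>X. \<lambda>i\<in>I. m i x) x i)"
        using PiE_mem[OF m i] cong[OF i, of "\<lambda>x. (\<lambda>x\<in>X. \<lambda>i\<in>I. m i x) x i" "m i"] i by simp
      assume "x \<in> X"
      moreover have "m i \<in> X \<rightarrow>\<^sub>E {1..N}" using PiE_mem[OF m i] by simp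
      ultimately show "m i x \<in> {1..N}" by (rule PiE_mem[rotated])
    qed
  qed
  then have "card ?B = (\<Prod>i\<in>I. card (?S i))"
    using assms(1) by (simp add: bij_betw_same_card card_PiE)
  also have "\<dots> = (\<Prod>i\<in>I. N ^ ncomp X (r i))"
    using assms by (intro prod.cong card_compatible) auto
  finally show ?thesis by (simp add: power_sum)
qed

lemma closed_colored_graph_matching:
  "closed_colored_graph I G \<Longrightarrow> i \<in> I \<Longrightarrow> perfect_matching (white G) (black G) (edges G i)"
  by (auto simp: closed_colored_graph_def perfect_matching_def)

lemma finite_perfect_matching:
  "finite V \<Longrightarrow> finite W \<Longrightarrow> perfect_matching V W m \<Longrightarrow> finite m"
  unfolding perfect_matching_def by (meson finite_SigmaI finite_subset)

text \<open>Stated for a bare family of edge sets, so that it applies to the colors of a graph and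
  to families glued from several labeled graphs alike.\<close>

definition index_compatible ::
  "nat \<Rightarrow> (nat \<Rightarrow> ('w \<times> 'b) set) \<Rightarrow> ('w + 'b \<Rightarrow> nat \<Rightarrow> nat) \<Rightarrow> bool" where
  "index_compatible D m n \<longleftrightarrow> (\<forall>i\<in>{1..D}. compatible (sum_edges (m i)) (\<lambda>x. n x i))"

lemma prod_indicator:
  "finite A \<Longrightarrow> (\<Prod>x\<in>A. if P x then 1 else (0::complex)) = (if \<forall>x\<in>A. P x then 1 else 0)"
  by (induction A rule: finite_induct) auto

lemma trace_operator_indicator:
  assumes "closed_colored_graph {1..D} G"
  shows "trace_operator D G n = (if index_compatible D (edges G) n then 1 else 0)"
proof -
  have fin: "finite (edges G i)" if "i \<in> {1..D}" for i
    using finite_perfect_matching[OF _ _ closed_colored_graph_matching[OF assms that]] assms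
    by (simp add: closed_colored_graph_def)
  have "trace_operator D G n = (\<Prod>i = 1..D.
      if compatible (sum_edges (edges G i)) (\<lambda>x. n x i) then 1 else 0)"
    unfolding trace_operator_def
  proof (rule prod.cong)
    fix i assume "i \<in> {1..D}"
    have "(\<Prod>(v, w)\<in>edges G i. if n (Inl v) i = n (Inr w) i then 1 else 0) =
        (\<Prod>e\<in>edges G i. if n (Inl (fst e)) i = n (Inr (snd e)) i then 1 else (0::complex))"
      by (intro prod.cong) auto
    also have "\<dots> = (if compatible (sum_edges (edges G i)) (\<lambda>x. n x i) then 1 else 0)"
      unfolding prod_indicator[OF fin[OF \<open>i \<in> {1..D}\<close>]]
      by (rule if_cong) (auto simp: compatible_def sum_edges_def)
    finally show "(\<Prod>(v, w)\<in>edges G i. if n (Inl v) i = n (Inr w) i then 1 else 0) =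
      (if compatible (sum_edges (edges G i)) (\<lambda>x. n x i) then 1 else (0::complex))" .
  qed simp
  also have "\<dots> = (if index_compatible D (edges G) n then 1 else 0)"
    unfolding index_compatible_def by (rule prod_indicator) simp
  finally show ?thesis .
qed

lemma sum_index_compatible:
  assumes "finite V" "finite W" "\<And>i. i \<in> {1..D} \<Longrightarrow> m i \<subseteq> V \<times> W" "\<And>i. i \<in> {1..D} \<Longrightarrow> m' i \<subseteq> V \<times> W"
  shows "(\<Sum>n\<in>(V <+> W) \<rightarrow>\<^sub>E tensor_indices D N.
      if index_compatible D m n \<and> index_compatible D m' n then 1 else 0) =
    (of_nat N ^ (\<Sum>i = 1..D. ncomp (V <+> W) (sum_edges (m i) \<union> sum_edges (m' i))) :: complex)"
proof -
  let ?A = "(V <+> W) \<rightarrow>\<^sub>E tensor_indices D N"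
  have fin: "finite ?A" using assms(1,2) by (intro finite_PiE) (auto simp: tensor_indices_def intro: finite_PiE)
  have "(\<Sum>n\<in>?A. if index_compatible D m n \<and> index_compatible D m' n then 1 else 0) =
      (of_nat (card {n \<in> ?A. index_compatible D m n \<and> index_compatible D m' n}) :: complex)"
    by (subst sum.inter_filter[OF fin, symmetric]) simp
  also have "{n \<in> ?A. index_compatible D m n \<and> index_compatible D m' n} =
      {n \<in> (V <+> W) \<rightarrow>\<^sub>E ({1..D} \<rightarrow>\<^sub>E {1..N}).
        \<forall>i\<in>{1..D}. compatible (sum_edges (m i) \<union> sum_edges (m' i)) (\<lambda>x. n x i)}"
    unfolding index_compatible_def tensor_indices_def compatible_def by blast
  also have "card \<dots> = N ^ (\<Sum>i = 1..D. ncomp (V <+> W) (sum_edges (m i) \<union> sum_edges (m' i)))"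
    using assms sum_edges_subset[of "m _" V W] sum_edges_subset[of "m' _" V W]
    by (intro card_compatible_colors) auto
  finally show ?thesis by simp
qed

section \<open>Cumulants and the expansion of the expected trace\<close>

lemma inj_on_map_sum:
  assumes "inj_on f (Inl -` S)" "inj_on g (Inr -` S)"
  shows "inj_on (map_sum f g) S"
proof (rule inj_onI)
  fix x y assume "x \<in> S" "y \<in> S" "map_sum f g x = map_sum f g y"
  then show "x = y" using assms by (cases x; cases y) (auto dest: inj_onD)
qed

lemma balanced_map_sum:
  assumes "inj_on f (Inl -` S)" "inj_on g (Inr -` S)"
  shows "balanced (map_sum f g ` S) \<longleftrightarrow> balanced S"
proof -
  have "Inl -` (map_sum f g ` S) = f ` (Inl -` S)"
  proof (intro equalityI subsetI)
    fix a assume "a \<in> Inl -` (map_sum f g ` S)"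
    then obtain x where "x \<in> S" "Inl a = map_sum f g x" by auto
    then show "a \<in> f ` (Inl -` S)" by (cases x) auto
  qed force
  moreover have "Inr -` (map_sum f g ` S) = g ` (Inr -` S)"
  proof (intro equalityI subsetI)
    fix a assume "a \<in> Inr -` (map_sum f g ` S)"
    then obtain x where "x \<in> S" "Inr a = map_sum f g x" by auto
    then show "a \<in> g ` (Inr -` S)" by (cases x) auto
  qed force
  ultimately show ?thesis using assms by (simp add: balanced_def card_image)
qed

lemma partition_on_inj_image':
  assumes "partition_on A P" "inj_on f A"
  shows "partition_on (f ` A) ((`) f ` P)"
proof -
  have "{} \<notin> (`) f ` P" using partition_onD3[OF assms(1)] by auto
  then show ?thesis using partition_on_inj_image[OF assms] by (simp add: Diff_insert0)
qed

lemma bij_betw_balanced_partitions: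
  assumes inj: "inj_on f (Inl -` S)" "inj_on g (Inr -` S)"
  shows "bij_betw ((`) ((`) (map_sum f g))) (balanced_partitions S) (balanced_partitions (map_sum f g ` S))"
proof -
  let ?\<phi> = "map_sum f g"
  have inj\<phi>: "inj_on ?\<phi> S" using inj by (rule inj_on_map_sum)
  have bal: "balanced (?\<phi> ` b) \<longleftrightarrow> balanced b" if "b \<subseteq> S" for b
    using that by (intro balanced_map_sum inj_on_subset[OF inj(1)] inj_on_subset[OF inj(2)] vimage_mono)
  have img: "(`) ?\<phi> ` P \<in> balanced_partitions (?\<phi> ` S) \<longleftrightarrow> P \<in> balanced_partitions S"
    if "partition_on S P" for P
    using partition_on_inj_image'[OF that inj\<phi>] that bal partition_onD1[OF that]
    by (auto simp: balanced_partitions_def)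
  show ?thesis
  proof (rule bij_betw_imageI)
    have "inj_on ((`) ?\<phi>) (Pow S)" using inj\<phi> by (rule inj_on_image_Pow)
    then have "inj_on ((`) ((`) ?\<phi>)) (Pow (Pow S))" by (rule inj_on_image_Pow)
    then show "inj_on ((`) ((`) ?\<phi>)) (balanced_partitions S)"
      by (rule inj_on_subset) (auto simp: balanced_partitions_def partition_on_def)
    show "(`) ((`) ?\<phi>) ` balanced_partitions S = balanced_partitions (?\<phi> ` S)"
    proof (intro equalityI subsetI)
      fix Q assume Q: "Q \<in> balanced_partitions (?\<phi> ` S)"
      then have part: "partition_on (?\<phi> ` S) Q" by (simp add: balanced_partitions_def)
      let ?P = "(`) (inv_into S ?\<phi>) ` Q"
      have "partition_on (inv_into S ?\<phi> ` ?\<phi> ` S) ?P"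
        by (rule partition_on_inj_image'[OF part inj_on_inv_into]) simp
      moreover have "inv_into S ?\<phi> ` ?\<phi> ` S = S" by (rule inv_into_image_cancel[OF inj\<phi> order_refl])
      ultimately have P: "partition_on S ?P" by simp
      have "?\<phi> ` inv_into S ?\<phi> ` c = c" if "c \<in> Q" for c
        using that part by (intro image_inv_into_cancel[OF refl]) (auto simp: partition_on_def)
      then have "(`) ?\<phi> ` ?P = Q" by (simp add: image_image)
      then show "Q \<in> (`) ((`) ?\<phi>) ` balanced_partitions S" using img[OF P] Q by (metis image_eqI)
    next
      fix Q assume "Q \<in> (`) ((`) ?\<phi>) ` balanced_partitions S"
      then obtain P where "P \<in> balanced_partitions S" "Q = (`) ?\<phi> ` P" by auto
      then show "Q \<in> balanced_partitions (?\<phi> ` S)" using img[of P] by (simp add: balanced_partitions_def)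
    qed
  qed
qed

text \<open>The recursion sees labels only through the moments of subsets and the balanced
  partitions, and a relabeling transports both. This is needed because
  \<open>trace_invariant\<close> speaks of the labels \<open>{1..k}\<close>, while the blocks
  consist of vertices of \<open>B\<close>.\<close>

lemma cumulant_map_sum:
  assumes "finite S" "inj_on f (Inl -` S)" "inj_on g (Inr -` S)"
    and "\<And>A. A \<subseteq> S \<Longrightarrow> m (map_sum f g ` A) = m' A"
  shows "cumulant m (map_sum f g ` S) = cumulant m' S"
  using assms
proof (induction S rule: finite_psubset_induct)
  case (psubset S)
  let ?\<phi> = "map_sum f g"
  note inj = psubset.prems(1,2)
  have IH: "cumulant m (?\<phi> ` b) = cumulant m' b" if b: "b \<subset> S" for b
  proof (rule psubset.IH[OF b])
    show "inj_on f (Inl -` b)" "inj_on g (Inr -` b)"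
      using b by (auto intro: inj_on_subset[OF inj(1)] inj_on_subset[OF inj(2)])
    show "m (?\<phi> ` A) = m' A" if "A \<subseteq> b" for A
      using that b by (intro psubset.prems(3)) auto
  qed
  have inj\<phi>: "inj_on ?\<phi> S" using inj by (rule inj_on_map_sum)
  have bij: "bij_betw ((`) ((`) ?\<phi>)) (balanced_partitions S) (balanced_partitions (?\<phi> ` S))"
    using inj by (rule bij_betw_balanced_partitions)
  \<comment> \<open>The one-block partitions correspond to each other, so the sums subtracted in the
    two recursions match term by term.\<close>
  have "bij_betw ((`) ((`) ?\<phi>)) (balanced_partitions S - {{S}}) (balanced_partitions (?\<phi> ` S) - {{?\<phi> ` S}})"
  proof (rule bij_betw_subset[OF bij])
    have eq: "(`) ?\<phi> ` P = {?\<phi> ` S} \<longleftrightarrow> P = {S}" if "P \<in> balanced_partitions S" for P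
    proof
      assume P: "(`) ?\<phi> ` P = {?\<phi> ` S}"
      have "c = S" if "c \<in> P" for c
      proof -
        have "c \<subseteq> S" using that \<open>P \<in> balanced_partitions S\<close>
          by (auto simp: balanced_partitions_def partition_on_def)
        moreover have "?\<phi> ` c = ?\<phi> ` S" using imageI[OF that, of "(`) ?\<phi>"] unfolding P by simp
        ultimately show ?thesis using inj_on_image_eq_iff[OF inj\<phi>] by blast
      qed
      moreover have "P \<noteq> {}" using P by auto
      ultimately show "P = {S}" by blast
    qed simp
    have surj: "(`) ((`) ?\<phi>) ` balanced_partitions S = balanced_partitions (?\<phi> ` S)"
      using bij by (simp add: bij_betw_def)
    show "(`) ((`) ?\<phi>) ` (balanced_partitions S - {{S}}) = balanced_partitions (?\<phi> ` S) - {{?\<phi> ` S}}"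
    proof (intro equalityI subsetI)
      fix Q assume "Q \<in> (`) ((`) ?\<phi>) ` (balanced_partitions S - {{S}})"
      then obtain P where P: "P \<in> balanced_partitions S" "P \<noteq> {S}" "Q = (`) ?\<phi> ` P"
        by (elim imageE DiffE) simp
      then have "Q \<noteq> {?\<phi> ` S}" using eq[OF P(1)] by simp
      moreover have "Q \<in> balanced_partitions (?\<phi> ` S)"
        unfolding surj[symmetric] P(3) using P(1) by (rule imageI)
      ultimately show "Q \<in> balanced_partitions (?\<phi> ` S) - {{?\<phi> ` S}}" by simp
    next
      fix Q assume "Q \<in> balanced_partitions (?\<phi> ` S) - {{?\<phi> ` S}}"
      then obtain P where P: "P \<in> balanced_partitions S" "Q = (`) ?\<phi> ` P" "Q \<noteq> {?\<phi> ` S}"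
        unfolding surj[symmetric] by (elim imageE DiffE) simp
      then have "P \<in> balanced_partitions S - {{S}}" using eq[OF P(1)] by simp
      then show "Q \<in> (`) ((`) ?\<phi>) ` (balanced_partitions S - {{S}})"
        unfolding P(2) by (rule imageI)
    qed
  qed simp
  then have "(\<Sum>Q\<in>balanced_partitions (?\<phi> ` S) - {{?\<phi> ` S}}. \<Prod>b\<in>Q. cumulant m b) =
      (\<Sum>P\<in>balanced_partitions S - {{S}}. \<Prod>b\<in>(`) ?\<phi> ` P. cumulant m b)"
    by (rule sum.reindex_bij_betw[symmetric])
  also have "\<dots> = (\<Sum>P\<in>balanced_partitions S - {{S}}. \<Prod>b\<in>P. cumulant m' b)"
  proof (rule sum.cong)
    fix P assume P: "P \<in> balanced_partitions S - {{S}}"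
    then have sub: "b \<subseteq> S" if "b \<in> P" for b
      using that by (auto simp: balanced_partitions_def partition_on_def)
    have "inj_on ((`) ?\<phi>) P"
      by (rule inj_on_subset[OF inj_on_image_Pow[OF inj\<phi>]]) (use sub in auto)
    then have "(\<Prod>b\<in>(`) ?\<phi> ` P. cumulant m b) = (\<Prod>b\<in>P. cumulant m (?\<phi> ` b))"
      by (simp add: prod.reindex)
    also have "\<dots> = (\<Prod>b\<in>P. cumulant m' b)"
    proof (rule prod.cong)
      fix b assume "b \<in> P"
      then have "b \<subset> S" using sub balanced_partitions_card_less[OF psubset.hyps P] by auto
      then show "cumulant m (?\<phi> ` b) = cumulant m' b" by (rule IH)
    qed simp
    finally show "(\<Prod>b\<in>(`) ?\<phi> ` P. cumulant m b) = (\<Prod>b\<in>P. cumulant m' b)" .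
  qed simp
  finally show ?case
    using psubset.hyps psubset.prems(3)[of S] by (simp add: cumulant.simps[of _ S] cumulant.simps[of _ "?\<phi> ` S"])
qed

lemma entry_product_map_sum:
  assumes "inj_on (map_sum f g) A"
  shows "entry_product T n (map_sum f g ` A) = entry_product T (n \<circ> map_sum f g) A"
proof
  fix \<omega>
  have "entry_product T n (map_sum f g ` A) \<omega> =
      (\<Prod>x\<in>A. case map_sum f g x of Inl v \<Rightarrow> T (n (map_sum f g x)) \<omega> | Inr w \<Rightarrow> cnj (T (n (map_sum f g x)) \<omega>))"
    unfolding entry_product_def using assms by (simp add: prod.reindex)
  also have "\<dots> = entry_product T (n \<circ> map_sum f g) A \<omega>"
    unfolding entry_product_def by (intro prod.cong) (auto split: sum.split)
  finally show "entry_product T n (map_sum f g ` A) \<omega> = entry_product T (n \<circ> map_sum f g) A \<omega>" .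
qed

lemma map_sum_image_Plus: "map_sum f g ` (A <+> B) = f ` A <+> g ` B"
  by (force simp: Plus_def)

lemma vimage_Plus: "Inl -` (A <+> B) = A" "Inr -` (A <+> B) = B"
  by auto

text \<open>Pull the index assignment back along the numberings \<open>f\<close> and
  \<open>g\<close>, apply trace invariance there, and push the edges of each labeled graph forward
  to the vertices of the block.\<close>

lemma cumulant_trace_invariant:
  assumes inv: "trace_invariant D N M T K" and "k \<ge> 1"
    and f: "bij_betw f {1..k} V" and g: "bij_betw g {1..k} W"
    and n: "n \<in> (V <+> W) \<rightarrow> tensor_indices D N"
  shows "cumulant (joint_moment M T n) (V <+> W) =
    (\<Sum>H\<in>labeled_graphs D k.
      K H * (if index_compatible D (\<lambda>i. map_prod f g ` edges H i) n then 1 else 0))"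
proof -
  let ?\<phi> = "map_sum f g" and ?L = "{1..k} <+> {1..k}"
  have inj: "inj_on f (Inl -` ?L)" "inj_on g (Inr -` ?L)"
    using f g by (simp_all add: vimage_Plus bij_betw_def)
  have L: "?\<phi> ` ?L = V <+> W" using f g by (simp add: map_sum_image_Plus bij_betw_def)
  have "cumulant (joint_moment M T n) (V <+> W) = cumulant (joint_moment M T (n \<circ> ?\<phi>)) ?L"
    unfolding L[symmetric]
  proof (rule cumulant_map_sum[OF _ inj])
    fix A assume "A \<subseteq> ?L"
    then have "inj_on ?\<phi> A" using inj_on_map_sum[OF inj] inj_on_subset by blast
    then show "joint_moment M T n (?\<phi> ` A) = joint_moment M T (n \<circ> ?\<phi>) A"
      by (simp add: joint_moment_def entry_product_map_sum)
  qed simp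
  also have "\<dots> = (\<Sum>H\<in>labeled_graphs D k. K H * trace_operator D H (n \<circ> ?\<phi>))"
  proof -
    have "n \<circ> ?\<phi> \<in> ?L \<rightarrow> tensor_indices D N" using n unfolding L[symmetric] Pi_iff by simp
    then show ?thesis using inv \<open>k \<ge> 1\<close> unfolding trace_invariant_def by blast
  qed
  also have "\<dots> = (\<Sum>H\<in>labeled_graphs D k.
      K H * (if index_compatible D (\<lambda>i. map_prod f g ` edges H i) n then 1 else 0))"
  proof (rule sum.cong)
    fix H assume "H \<in> labeled_graphs D k"
    then have "closed_colored_graph {1..D} H" by (simp add: labeled_graphs_def)
    moreover have "index_compatible D (edges H) (n \<circ> ?\<phi>) \<longleftrightarrow>
        index_compatible D (\<lambda>i. map_prod f g ` edges H i) n"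
      by (simp add: index_compatible_def compatible_def sum_edges_def case_prod_unfold)
    ultimately show "K H * trace_operator D H (n \<circ> ?\<phi>) =
        K H * (if index_compatible D (\<lambda>i. map_prod f g ` edges H i) n then 1 else 0)"
      by (simp add: trace_operator_indicator)
  qed simp
  finally show ?thesis .
qed

lemma trace_inv_entry_product:
  assumes "closed_colored_graph I B"
  shows "trace_inv D N B (\<lambda>n. T n \<omega>) =
    (\<Sum>n\<in>vertices B \<rightarrow>\<^sub>E tensor_indices D N. trace_operator D B n * entry_product T n (vertices B) \<omega>)"
  using assms unfolding trace_inv_def entry_product_def closed_colored_graph_def vertices_def
  by (simp add: prod.Plus mult.assoc)

text \<open>\<open>finite_moments\<close> is phrased for labels in \<open>nat + nat\<close>, so the
  vertices are numbered first.\<close>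

lemma integrable_entry_product:
  fixes V :: "'w set" and W :: "'b set"
  assumes "finite_moments D N M T" "finite V" "finite W" "n \<in> (V <+> W) \<rightarrow> tensor_indices D N"
  shows "integrable M (entry_product T n (V <+> W))"
proof -
  obtain f g where f: "bij_betw f {1..card V} V" and g: "bij_betw g {1..card W} W"
    using assms(2,3) ex_bij_betw_nat_finite_1 by meson
  let ?L = "{1..card V} <+> {1..card W}"
  have L: "map_sum f g ` ?L = V <+> W" using f g by (simp add: map_sum_image_Plus bij_betw_def)
  have "inj_on (map_sum f g) ?L"
    using f g by (intro inj_on_map_sum) (simp_all add: vimage_Plus bij_betw_def)
  then have eq: "entry_product T n (V <+> W) = entry_product T (n \<circ> map_sum f g) ?L"
    unfolding L[symmetric] by (rule entry_product_map_sum)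
  have "n \<circ> map_sum f g \<in> ?L \<rightarrow> tensor_indices D N"
    using assms(4) unfolding L[symmetric] Pi_iff by simp
  then show ?thesis using assms(1) unfolding eq finite_moments_def by (meson finite_Plus finite_atLeastAtMost)
qed

lemma expected_trace_moments:
  assumes "closed_colored_graph I B" "finite_moments D N M T"
  shows "(\<integral>\<omega>. trace_inv D N B (\<lambda>n. T n \<omega>) \<partial>M) =
    (\<Sum>n\<in>vertices B \<rightarrow>\<^sub>E tensor_indices D N. trace_operator D B n * joint_moment M T n (vertices B))"
proof -
  have fin: "finite (white B)" "finite (black B)" using assms(1) by (simp_all add: closed_colored_graph_def)
  have int: "integrable M (entry_product T n (vertices B))"
    if "n \<in> vertices B \<rightarrow>\<^sub>E tensor_indices D N" for n
    using integrable_entry_product[OF assms(2) fin, of n] that by (auto simp: vertices_def PiE_def)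
  show ?thesis
    unfolding trace_inv_entry_product[OF assms(1)] joint_moment_def
    by (simp add: int Bochner_Integration.integral_sum integrable_mult_right)
qed

section \<open>Graphs glued from labeled graphs on the blocks of a partition\<close>

definition glued_edges ::
  "(('w + 'b) set \<Rightarrow> nat \<Rightarrow> 'w) \<Rightarrow> (('w + 'b) set \<Rightarrow> nat \<Rightarrow> 'b) \<Rightarrow> ('w + 'b) set set \<Rightarrow>
    (('w + 'b) set \<Rightarrow> (nat, nat) colored_graph) \<Rightarrow> nat \<Rightarrow> ('w \<times> 'b) set" where
  "glued_edges f g \<pi> H i = (\<Union>b\<in>\<pi>. map_prod (f b) (g b) ` edges (H b) i)"

definition white_count :: "('w + 'b) set \<Rightarrow> nat" where
  "white_count b = card (Inl -` b)"

text \<open>One numbering per block, fixed once for all partitions; it lets a graph on the labels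
  \<open>{1..k}\<close> be read as a graph on the block. Any choice serves, since the sums run over
  all labeled graphs. Balance makes one count do for both kinds of vertices.\<close>

definition block_labeling ::
  "(('w + 'b) set \<Rightarrow> nat \<Rightarrow> 'w) \<Rightarrow> (('w + 'b) set \<Rightarrow> nat \<Rightarrow> 'b) \<Rightarrow> bool" where
  "block_labeling f g \<longleftrightarrow> (\<forall>b. finite b \<and> balanced b \<longrightarrow>
     bij_betw (f b) {1..white_count b} (Inl -` b) \<and> bij_betw (g b) {1..white_count b} (Inr -` b))"

lemma ex_block_labeling:
  "\<exists>f g. block_labeling (f :: ('w + 'b) set \<Rightarrow> nat \<Rightarrow> 'w) (g :: ('w + 'b) set \<Rightarrow> nat \<Rightarrow> 'b)"
proof -
  have "\<exists>p. finite b \<and> balanced b \<longrightarrow>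
      bij_betw (fst p) {1..white_count b} (Inl -` b) \<and> bij_betw (snd p) {1..white_count b} (Inr -` b)"
    for b :: "('w + 'b) set"
  proof (cases "finite b \<and> balanced b")
    case True
    then have "finite (Inl -` b)" "finite (Inr -` b)" by (auto intro: finite_vimageI)
    then obtain f g where "bij_betw f {1..card (Inl -` b)} (Inl -` b)" "bij_betw g {1..card (Inr -` b)} (Inr -` b)"
      using ex_bij_betw_nat_finite_1 by meson
    then show ?thesis using True by (intro exI[of _ "(f, g)"]) (simp add: white_count_def balanced_def)
  qed blast
  from choice[OF allI, OF this] obtain p where "\<forall>b :: ('w + 'b) set. finite b \<and> balanced b \<longrightarrow>
      bij_betw (fst (p b)) {1..white_count b} (Inl -` b) \<and> bij_betw (snd (p b)) {1..white_count b} (Inr -` b)"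
    by (rule exE)
  then have "block_labeling (\<lambda>b. fst (p b)) (\<lambda>b. snd (p b))" by (simp add: block_labeling_def)
  then show ?thesis by blast
qed

lemma block_eq_Plus: "b = Inl -` b <+> Inr -` b"
proof (rule set_eqI)
  fix x show "x \<in> b \<longleftrightarrow> x \<in> Inl -` b <+> Inr -` b" by (cases x) auto
qed

lemma balanced_blockD:
  assumes "finite X" "\<pi> \<in> balanced_partitions X" "b \<in> \<pi>"
  shows "finite b" "balanced b" "b \<subseteq> X" "white_count b \<ge> 1"
proof -
  show b: "balanced b" "b \<subseteq> X" using assms by (auto simp: balanced_partitions_def partition_on_def)
  then show fin: "finite b" using assms(1) finite_subset by blast
  have "b \<noteq> {}" using assms by (auto simp: balanced_partitions_def partition_on_def)
  then have "Inl -` b \<noteq> {} \<or> Inr -` b \<noteq> {}" using block_eq_Plus[of b] by auto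
  moreover have "finite (Inl -` b)" "finite (Inr -` b)" using fin by (auto intro: finite_vimageI)
  ultimately have "card (Inl -` b) \<noteq> 0 \<or> card (Inr -` b) \<noteq> 0" by simp
  then show "white_count b \<ge> 1" using b(1) by (simp add: white_count_def balanced_def)
qed

lemma index_compatible_UN:
  "index_compatible D (\<lambda>i. \<Union>b\<in>P. m b i) n \<longleftrightarrow> (\<forall>b\<in>P. index_compatible D (m b) n)"
proof -
  have "compatible (\<Union>b\<in>P. r b) h \<longleftrightarrow> (\<forall>b\<in>P. compatible (r b) h)" for r h
    by (auto simp: compatible_def)
  then show ?thesis by (auto simp: index_compatible_def sum_edges_UN)
qed

text \<open>Distributing the product over blocks across the sums given by trace invariance selects
  one labeled graph per block, and the product of the block indicators is the indicator of the glued
  family.\<close>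

lemma joint_moment_expansion:
  fixes X :: "('w + 'b) set"
  assumes inv: "trace_invariant D N M T K" and X: "finite X" "X \<noteq> {}" "balanced X"
    and lab: "block_labeling f g" and n: "n \<in> X \<rightarrow> tensor_indices D N"
  shows "joint_moment M T n X =
    (\<Sum>\<pi>\<in>balanced_partitions X. \<Sum>H\<in>PiE \<pi> (\<lambda>b. labeled_graphs D (white_count b)).
      (\<Prod>b\<in>\<pi>. K (H b)) * (if index_compatible D (glued_edges f g \<pi> H) n then 1 else 0))"
  unfolding moment_cumulant[OF X, of "joint_moment M T n"]
proof (rule sum.cong)
  fix \<pi> assume \<pi>: "\<pi> \<in> balanced_partitions X"
  have fin: "finite \<pi>" using \<pi> X(1) finite_elements by (auto simp: balanced_partitions_def)
  have "(\<Prod>b\<in>\<pi>. cumulant (joint_moment M T n) b) =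
      (\<Prod>b\<in>\<pi>. \<Sum>H\<in>labeled_graphs D (white_count b). K H *
        (if index_compatible D (\<lambda>i. map_prod (f b) (g b) ` edges H i) n then 1 else 0))"
  proof (rule prod.cong)
    fix b assume "b \<in> \<pi>"
    note b = balanced_blockD[OF X(1) \<pi> this]
    have l: "bij_betw (f b) {1..white_count b} (Inl -` b)" "bij_betw (g b) {1..white_count b} (Inr -` b)"
      using lab b by (auto simp: block_labeling_def)
    have "n \<in> (Inl -` b <+> Inr -` b) \<rightarrow> tensor_indices D N"
      using n b(3) unfolding block_eq_Plus[of b, symmetric] by auto
    from cumulant_trace_invariant[OF inv b(4) l this]
    show "cumulant (joint_moment M T n) b = (\<Sum>H\<in>labeled_graphs D (white_count b). K H *
        (if index_compatible D (\<lambda>i. map_prod (f b) (g b) ` edges H i) n then 1 else 0))"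
      unfolding block_eq_Plus[of b, symmetric] .
  qed simp
  also have "\<dots> = (\<Sum>H\<in>PiE \<pi> (\<lambda>b. labeled_graphs D (white_count b)). \<Prod>b\<in>\<pi>. K (H b) *
        (if index_compatible D (\<lambda>i. map_prod (f b) (g b) ` edges (H b) i) n then 1 else 0))"
    using fin by (intro prod_sum_PiE finite_labeled_graphs)
  also have "\<dots> = (\<Sum>H\<in>PiE \<pi> (\<lambda>b. labeled_graphs D (white_count b)).
      (\<Prod>b\<in>\<pi>. K (H b)) * (if index_compatible D (glued_edges f g \<pi> H) n then 1 else 0))"
    unfolding glued_edges_def index_compatible_UN prod.distrib prod_indicator[OF fin] ..
  finally show "(\<Prod>b\<in>\<pi>. cumulant (joint_moment M T n) b) =
    (\<Sum>H\<in>PiE \<pi> (\<lambda>b. labeled_graphs D (white_count b)).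
      (\<Prod>b\<in>\<pi>. K (H b)) * (if index_compatible D (glued_edges f g \<pi> H) n then 1 else 0))" .
qed simp

lemma perfect_matching_image:
  assumes "perfect_matching V W m" "bij_betw f V V'" "bij_betw g W W'"
  shows "perfect_matching V' W' (map_prod f g ` m)"
proof -
  obtain h where h: "bij_betw h V W" "m = {(v, h v) | v. v \<in> V}" by (rule perfect_matchingE[OF assms(1)])
  let ?h = "g \<circ> h \<circ> inv_into V f"
  have "map_prod f g ` m = {(f v, g (h v)) | v. v \<in> V}" unfolding h(2) by force
  also have "\<dots> = {(v, ?h v) | v. v \<in> V'}"
  proof (intro equalityI subsetI)
    fix e assume "e \<in> {(f v, g (h v)) | v. v \<in> V}"
    then obtain v where "v \<in> V" "e = (f v, g (h v))" by auto
    then show "e \<in> {(v, ?h v) | v. v \<in> V'}"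
      using assms(2) by (auto simp: bij_betw_def intro!: exI[of _ "f v"])
  next
    fix e assume "e \<in> {(v, ?h v) | v. v \<in> V'}"
    then obtain v where v: "v \<in> V'" "e = (v, ?h v)" by auto
    then have "v \<in> f ` V" using assms(2) by (simp add: bij_betw_def)
    then have "inv_into V f v \<in> V" "f (inv_into V f v) = v" by (rule inv_into_into, rule f_inv_into_f)
    then show "e \<in> {(f v, g (h v)) | v. v \<in> V}" using v(2) by (auto intro!: exI[of _ "inv_into V f v"])
  qed
  finally show ?thesis
    using perfect_matching_bij[OF bij_betw_trans[OF bij_betw_inv_into[OF assms(2)] bij_betw_trans[OF h(1) assms(3)]]]
    by (simp add: comp_assoc)
qed

text \<open>Blocks are disjoint, so only the matching of its own block meets a given vertex.\<close>

lemma perfect_matching_UN: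
  assumes P: "partition_on X P" and m: "\<And>b. b \<in> P \<Longrightarrow> perfect_matching (Inl -` b) (Inr -` b) (m b)"
  shows "perfect_matching (Inl -` X) (Inr -` X) (\<Union>b\<in>P. m b)"
proof -
  have sub: "Inl v \<in> b" "Inr w \<in> b" if "b \<in> P" "(v, w) \<in> m b" for v w b
    using m[OF that(1)] that(2) by (auto simp: perfect_matching_def)
  have eq: "b = c" if "b \<in> P" "c \<in> P" "x \<in> b" "x \<in> c" for b c x
    using partition_onD2[OF P] that by (auto simp: disjoint_def)
  have cover: "\<exists>b\<in>P. x \<in> b" if "x \<in> X" for x using partition_onD1[OF P] that by auto
  show ?thesis
    unfolding perfect_matching_def
  proof (intro conjI ballI)
    show "(\<Union>b\<in>P. m b) \<subseteq> Inl -` X \<times> Inr -` X"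
      using sub unfolding partition_onD1[OF P] by fast
  next
    fix v assume "v \<in> Inl -` X"
    then obtain b where b: "b \<in> P" "Inl v \<in> b" using cover by auto
    then have ex: "\<exists>!w. (v, w) \<in> m b" using m[OF b(1)] by (simp add: perfect_matching_def)
    have "(v, w) \<in> (\<Union>b\<in>P. m b) \<longleftrightarrow> (v, w) \<in> m b" for w
      using b eq[OF _ b(1)] sub(1) by (metis UN_iff)
    then show "\<exists>!w. (v, w) \<in> (\<Union>b\<in>P. m b)" using ex by simp
  next
    fix w assume "w \<in> Inr -` X"
    then obtain b where b: "b \<in> P" "Inr w \<in> b" using cover by auto
    then have ex: "\<exists>!v. (v, w) \<in> m b" using m[OF b(1)] by (simp add: perfect_matching_def)
    have "(v, w) \<in> (\<Union>b\<in>P. m b) \<longleftrightarrow> (v, w) \<in> m b" for v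
      using b eq[OF _ b(1)] sub(2) by (metis UN_iff)
    then show "\<exists>!v. (v, w) \<in> (\<Union>b\<in>P. m b)" using ex by simp
  qed
qed

lemma block_matching:
  assumes "block_labeling f g" "finite X" "\<pi> \<in> balanced_partitions X" "b \<in> \<pi>"
    and "H \<in> PiE \<pi> (\<lambda>b. labeled_graphs D (white_count b))" "i \<in> {1..D}"
  shows "perfect_matching (Inl -` b) (Inr -` b) (map_prod (f b) (g b) ` edges (H b) i)"
proof (rule perfect_matching_image)
  have "H b \<in> labeled_graphs D (white_count b)" using assms(5,4) by (rule PiE_mem)
  then show "perfect_matching {1..white_count b} {1..white_count b} (edges (H b) i)"
    using closed_colored_graph_matching[OF _ assms(6), of "H b"] by (simp add: labeled_graphs_def)
  show "bij_betw (f b) {1..white_count b} (Inl -` b)" "bij_betw (g b) {1..white_count b} (Inr -` b)"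
    using assms(1) balanced_blockD[OF assms(2,3,4)] by (simp_all add: block_labeling_def)
qed

lemma glued_edges_matching:
  assumes "block_labeling f g" "finite X" "\<pi> \<in> balanced_partitions X"
    and "H \<in> PiE \<pi> (\<lambda>b. labeled_graphs D (white_count b))" "i \<in> {1..D}"
  shows "perfect_matching (Inl -` X) (Inr -` X) (glued_edges f g \<pi> H i)"
  unfolding glued_edges_def
  using assms block_matching[OF assms(1-3)]
  by (intro perfect_matching_UN) (auto simp: balanced_partitions_def)

lemma expected_trace_expansion:
  fixes B :: "('w, 'b) colored_graph"
  assumes B: "closed_colored_graph {1..D} B" "vertices B \<noteq> {}"
    and "finite_moments D N M T" and inv: "trace_invariant D N M T K" and lab: "block_labeling f g"
  shows "(\<integral>\<omega>. trace_inv D N B (\<lambda>n. T n \<omega>) \<partial>M) =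
    (\<Sum>\<pi>\<in>balanced_partitions (vertices B). \<Sum>H\<in>PiE \<pi> (\<lambda>b. labeled_graphs D (white_count b)).
      (\<Prod>b\<in>\<pi>. K (H b)) * of_nat N ^
        (\<Sum>i = 1..D. ncomp (vertices B) (sum_edges (edges B i) \<union> sum_edges (glued_edges f g \<pi> H i))))"
proof -
  let ?X = "vertices B" and ?P = "\<lambda>\<pi>. PiE \<pi> (\<lambda>b. labeled_graphs D (white_count b))"
  let ?A = "?X \<rightarrow>\<^sub>E tensor_indices D N"
  let ?c = "\<lambda>n. index_compatible D (edges B) n"
  let ?d = "\<lambda>\<pi> H n. index_compatible D (glued_edges f g \<pi> H) n"
  have X: "?X = white B <+> black B" by (simp add: vertices_def)
  have fin: "finite (white B)" "finite (black B)" "card (white B) = card (black B)"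
    using B(1) by (auto simp: closed_colored_graph_def)
  then have bal: "finite ?X" "balanced ?X" by (simp_all add: X balanced_def vimage_Plus)
  have "(\<integral>\<omega>. trace_inv D N B (\<lambda>n. T n \<omega>) \<partial>M) =
      (\<Sum>n\<in>?A. trace_operator D B n * joint_moment M T n ?X)"
    using B(1) assms(3) by (rule expected_trace_moments)
  also have "\<dots> = (\<Sum>n\<in>?A. \<Sum>\<pi>\<in>balanced_partitions ?X. \<Sum>H\<in>?P \<pi>.
      (\<Prod>b\<in>\<pi>. K (H b)) * (if ?c n \<and> ?d \<pi> H n then 1 else 0))"
  proof (rule sum.cong)
    fix n assume "n \<in> ?A"
    then have n: "n \<in> ?X \<rightarrow> tensor_indices D N" by (simp add: PiE_def)
    show "trace_operator D B n * joint_moment M T n ?X = (\<Sum>\<pi>\<in>balanced_partitions ?X. \<Sum>H\<in>?P \<pi>.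
        (\<Prod>b\<in>\<pi>. K (H b)) * (if ?c n \<and> ?d \<pi> H n then 1 else 0))"
      unfolding trace_operator_indicator[OF B(1)]
        joint_moment_expansion[OF inv bal(1) B(2) bal(2) lab n] sum_distrib_left
      by (intro sum.cong) auto
  qed simp
  also have "\<dots> = (\<Sum>\<pi>\<in>balanced_partitions ?X. \<Sum>n\<in>?A. \<Sum>H\<in>?P \<pi>.
      (\<Prod>b\<in>\<pi>. K (H b)) * (if ?c n \<and> ?d \<pi> H n then 1 else 0))"
    by (rule sum.swap)
  also have "\<dots> = (\<Sum>\<pi>\<in>balanced_partitions ?X. \<Sum>H\<in>?P \<pi>. (\<Prod>b\<in>\<pi>. K (H b)) * of_nat N ^
      (\<Sum>i = 1..D. ncomp ?X (sum_edges (edges B i) \<union> sum_edges (glued_edges f g \<pi> H i))))"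
  proof (rule sum.cong)
    fix \<pi> assume \<pi>: "\<pi> \<in> balanced_partitions ?X"
    have "(\<Sum>n\<in>?A. if ?c n \<and> ?d \<pi> H n then 1 else 0) = (of_nat N ^
        (\<Sum>i = 1..D. ncomp ?X (sum_edges (edges B i) \<union> sum_edges (glued_edges f g \<pi> H i))) :: complex)"
      if H: "H \<in> ?P \<pi>" for H
      unfolding X
    proof (rule sum_index_compatible[OF fin(1,2)])
      fix i assume i: "i \<in> {1..D}"
      show "edges B i \<subseteq> white B \<times> black B" using B(1) i by (simp add: closed_colored_graph_def)
      show "glued_edges f g \<pi> H i \<subseteq> white B \<times> black B"
        using glued_edges_matching[OF lab bal(1) \<pi> H i] by (simp add: X vimage_Plus perfect_matching_def)
    qed
    then show "(\<Sum>n\<in>?A. \<Sum>H\<in>?P \<pi>. (\<Prod>b\<in>\<pi>. K (H b)) * (if ?c n \<and> ?d \<pi> H n then 1 else 0)) =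
      (\<Sum>H\<in>?P \<pi>. (\<Prod>b\<in>\<pi>. K (H b)) * of_nat N ^
        (\<Sum>i = 1..D. ncomp ?X (sum_edges (edges B i) \<union> sum_edges (glued_edges f g \<pi> H i))))"
      by (subst sum.swap) (simp add: sum_distrib_left[symmetric])
  qed simp
  finally show ?thesis .
qed

section \<open>Counting faces\<close>

lemma adjacency_eq: "adjacency J G = (\<Union>i\<in>J. sum_edges (edges G i))"
proof (intro equalityI subrelI)
  fix x y assume "(x, y) \<in> adjacency J G"
  then obtain v w i where "x = Inl v" "y = Inr w" "i \<in> J" "(v, w) \<in> edges G i"
    by (auto simp: adjacency_def)
  then show "(x, y) \<in> (\<Union>i\<in>J. sum_edges (edges G i))" by (intro UN_I[of i]) (simp_all add: mem_sum_edges)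
next
  fix x y assume "(x, y) \<in> (\<Union>i\<in>J. sum_edges (edges G i))"
  then show "(x, y) \<in> adjacency J G" unfolding adjacency_def by (auto simp: mem_sum_edges)
qed

lemma closed_colored_graph_iff:
  "closed_colored_graph I G \<longleftrightarrow>
     finite (white G) \<and> finite (black G) \<and> card (white G) = card (black G) \<and>
     (\<forall>i\<in>I. perfect_matching (white G) (black G) (edges G i)) \<and> (\<forall>i. i \<notin> I \<longrightarrow> edges G i = {})"
  by (simp add: closed_colored_graph_def perfect_matching_def)

text \<open>The bridge from faces and connected components of colored graphs to
  \<open>ncomp\<close>.\<close>

lemma card_graph_components:
  "card (graph_components J G) = ncomp (vertices G) (\<Union>i\<in>J. sum_edges (edges G i))"
  by (simp add: graph_components_def ncomp_def conn_def adjacency_eq)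

lemma num_components_dipole:
  assumes "D \<ge> 1"
  shows "num_components (dipole D) = 1"
proof -
  have "adjacency UNIV (dipole D) = {(Inl 1, Inr 1)}"
    using assms by (auto simp: adjacency_def dipole_def split: if_splits intro!: exI[of _ 1])
  then have e: "(\<Union>i\<in>UNIV. sum_edges (edges (dipole D) i)) = {(Inl 1, Inr 1)}"
    by (simp add: adjacency_eq)
  let ?X = "{Inl 1, Inr 1} :: (nat + nat) set"
  have "ncomp ?X {} = Suc (ncomp ?X {(Inl 1, Inr 1)})"
    by (rule ncomp_insert_disconnected) (auto simp: conn_def)
  moreover have "vertices (dipole D) = {Inl 1, Inr 1}" by (auto simp: vertices_def dipole_def)
  ultimately show ?thesis unfolding num_components_def card_graph_components e by (simp add: ncomp_empty)
qed

section \<open>Covering graphs as perfect matchings\<close>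

definition add_matching :: "('w, 'b) colored_graph \<Rightarrow> ('w \<times> 'b) set \<Rightarrow> ('w, 'b) colored_graph" where
  "add_matching B s = B\<lparr>edges := (edges B)(0 := s)\<rparr>"

definition matching_faces :: "nat \<Rightarrow> ('w, 'b) colored_graph \<Rightarrow> ('w \<times> 'b) set \<Rightarrow> nat" where
  "matching_faces D B s = (\<Sum>i = 1..D. ncomp (vertices B) (sum_edges (edges B i) \<union> sum_edges s))"

lemma num_faces0_add_matching: "num_faces0 D (add_matching B s) = matching_faces D B s"
  unfolding num_faces0_def matching_faces_def num_faces_def card_graph_components
  by (intro sum.cong) (auto simp: add_matching_def vertices_def Un_commute)

text \<open>The edges of color 0 determine a covering graph, and every perfect matching can serve as
  these. Because \<open>edges B 0\<close> is empty, adding and deleting color 0 are mutually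
  inverse.\<close>

lemma bij_betw_covering_graphs:
  assumes "closed_colored_graph {1..D} B"
  shows "bij_betw (add_matching B) {s. perfect_matching (white B) (black B) s} (covering_graphs D B)"
proof (rule bij_betw_byWitness[where f' = "\<lambda>G. edges G 0"])
  have B0: "edges B 0 = {}" using assms by (simp add: closed_colored_graph_def)
  show "\<forall>s\<in>{s. perfect_matching (white B) (black B) s}. edges (add_matching B s) 0 = s"
    by (simp add: add_matching_def)
  show "\<forall>G\<in>covering_graphs D B. add_matching B (edges G 0) = G"
    by (auto simp: covering_graphs_def delete_color_def add_matching_def)
  show "add_matching B ` {s. perfect_matching (white B) (black B) s} \<subseteq> covering_graphs D B"
    using assms B0
    by (auto simp: add_matching_def covering_graphs_def closed_colored_graph_iff delete_color_def fun_upd_idem)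
  show "(\<lambda>G. edges G 0) ` covering_graphs D B \<subseteq> {s. perfect_matching (white B) (black B) s}"
  proof (intro image_subsetI CollectI)
    fix G assume G: "G \<in> covering_graphs D B"
    then have "perfect_matching (white G) (black G) (edges G 0)"
      by (intro closed_colored_graph_matching[of "{0..D}"]) (simp_all add: covering_graphs_def)
    moreover have "white G = white B" "black G = black B"
      using G by (auto simp: covering_graphs_def delete_color_def)
    ultimately show "perfect_matching (white B) (black B) (edges G 0)" by simp
  qed
qed

lemma matching_faces_le_Max:
  assumes "closed_colored_graph {1..D} B" "perfect_matching (white B) (black B) s"
  shows "matching_faces D B s \<le> Max (num_faces0 D ` covering_graphs D B)"
proof -
  have "add_matching B s \<in> covering_graphs D B"
    using bij_betw_apply[OF bij_betw_covering_graphs[OF assms(1)]] assms(2) by simp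
  then show ?thesis
    unfolding num_faces0_add_matching[symmetric] using finite_covering_graphs[OF assms(1)]
    by (intro Max_ge finite_imageI imageI)
qed

text \<open>Minimal covering graphs are those attaining the maximum in \<open>Omega\<close>, which
  is the condition for a pairing to contribute with exponent zero.\<close>

lemma R_number_eq:
  assumes B: "closed_colored_graph {1..D} B"
  shows "R_number D B = card {s. perfect_matching (white B) (black B) s \<and>
    matching_faces D B s = Max (num_faces0 D ` covering_graphs D B)}"
proof -
  let ?M = "Max (num_faces0 D ` covering_graphs D B)" and ?S = "{s. perfect_matching (white B) (black B) s}"
  have bij: "bij_betw (add_matching B) ?S (covering_graphs D B)"
    by (rule bij_betw_covering_graphs[OF B])
  have fin: "finite (num_faces0 D ` covering_graphs D B)"
    by (intro finite_imageI finite_covering_graphs[OF B])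
  have "minimal_covering_graphs D B = {G \<in> covering_graphs D B. num_faces0 D G = ?M}"
  proof (intro equalityI subsetI)
    fix G assume "G \<in> minimal_covering_graphs D B"
    then have G: "G \<in> covering_graphs D B" "\<And>H. H \<in> covering_graphs D B \<Longrightarrow> num_faces0 D H \<le> num_faces0 D G"
      by (auto simp: minimal_covering_graphs_def)
    then have "?M = num_faces0 D G" using fin by (intro Max_eqI) auto
    then show "G \<in> {G \<in> covering_graphs D B. num_faces0 D G = ?M}" using G(1) by simp
  next
    fix G assume "G \<in> {G \<in> covering_graphs D B. num_faces0 D G = ?M}"
    then show "G \<in> minimal_covering_graphs D B"
      using fin by (auto simp: minimal_covering_graphs_def)
  qed
  also have "\<dots> = add_matching B ` {s \<in> ?S. matching_faces D B s = ?M}"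
    using bij unfolding bij_betw_def by (auto simp: num_faces0_add_matching[symmetric])
  finally have eq: "minimal_covering_graphs D B = add_matching B ` {s \<in> ?S. matching_faces D B s = ?M}" .
  have "inj_on (add_matching B) {s \<in> ?S. matching_faces D B s = ?M}"
    using bij by (auto simp: bij_betw_def intro: inj_on_subset)
  then show ?thesis unfolding R_number_def eq by (simp add: card_image)
qed

section \<open>The exponent of a term with a block larger than a pair\<close>

lemma sum_white_count:
  assumes "finite X" "\<pi> \<in> balanced_partitions X"
  shows "(\<Sum>b\<in>\<pi>. white_count b) = card (Inl -` X)"
proof -
  have P: "partition_on X \<pi>" using assms(2) by (simp add: balanced_partitions_def)
  have "Inl -` X = (\<Union>b\<in>\<pi>. Inl -` b)" using partition_onD1[OF P] by auto
  moreover have "card (\<Union>b\<in>\<pi>. (Inl -` b :: 'a set)) = (\<Sum>b\<in>\<pi>. card (Inl -` b :: 'a set))"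
  proof (rule card_UN_disjoint)
    show "finite \<pi>" using finite_elements[OF assms(1) P] .
    show "\<forall>b\<in>\<pi>. finite (Inl -` b :: 'a set)"
      using balanced_blockD(1)[OF assms] by (auto intro: finite_vimageI)
    show "\<forall>b\<in>\<pi>. \<forall>c\<in>\<pi>. b \<noteq> c \<longrightarrow> Inl -` b \<inter> Inl -` c = ({} :: 'a set)"
      using partition_onD2[OF P] by (fastforce simp: disjoint_def)
  qed
  ultimately show ?thesis by (simp add: white_count_def)
qed

text \<open>Numbering a block carries connected vertices of \<open>H b\<close> to connected vertices
  of the union, so gluing creates no further components.\<close>

lemma ncomp_glued_le:
  assumes lab: "block_labeling f g" and X: "finite X" "\<pi> \<in> balanced_partitions X"
    and H: "H \<in> PiE \<pi> (\<lambda>b. labeled_graphs D (white_count b))"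
  shows "ncomp X (\<Union>i\<in>{1..D}. sum_edges (glued_edges f g \<pi> H i)) \<le> (\<Sum>b\<in>\<pi>. num_components (H b))"
proof -
  have P: "partition_on X \<pi>" using X(2) by (simp add: balanced_partitions_def)
  have "ncomp X (\<Union>i\<in>{1..D}. sum_edges (glued_edges f g \<pi> H i)) \<le>
      (\<Sum>b\<in>\<pi>. ncomp (vertices (H b)) (\<Union>i\<in>UNIV. sum_edges (edges (H b) i)))"
  proof (rule ncomp_le_sum)
    show "finite \<pi>" using finite_elements[OF X(1) P] .
    have Hb: "closed_colored_graph {1..D} (H b)" "vertices (H b) = {1..white_count b} <+> {1..white_count b}"
      if "b \<in> \<pi>" for b
      using PiE_mem[OF H that] by (simp_all add: labeled_graphs_def vertices_def)
    show "finite (vertices (H b))" if "b \<in> \<pi>" for b using Hb(2)[OF that] by simp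
    have "map_sum (f b) (g b) ` vertices (H b) = b" if "b \<in> \<pi>" for b
      using lab balanced_blockD[OF X that] block_eq_Plus[of b]
      by (simp add: Hb(2)[OF that] map_sum_image_Plus block_labeling_def bij_betw_def)
    then show "X \<subseteq> (\<Union>b\<in>\<pi>. map_sum (f b) (g b) ` vertices (H b))"
      using partition_onD1[OF P] by simp
    fix b x y assume b: "b \<in> \<pi>" and "(x, y) \<in> (\<Union>i\<in>UNIV. sum_edges (edges (H b) i))"
    then obtain i v w where e: "x = Inl v" "y = Inr w" "(v, w) \<in> edges (H b) i"
      by (auto simp: mem_sum_edges)
    then have "i \<in> {1..D}" using Hb(1)[OF b] unfolding closed_colored_graph_def by blast
    moreover have "(f b v, g b w) \<in> glued_edges f g \<pi> H i" using e(3) b by (force simp: glued_edges_def)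
    ultimately show "(map_sum (f b) (g b) x, map_sum (f b) (g b) y) \<in>
        conn (\<Union>i\<in>{1..D}. sum_edges (glued_edges f g \<pi> H i))"
      unfolding e by (intro conn_base UN_I[of i]) (auto simp: mem_sum_edges)
  qed
  then show ?thesis by (simp add: num_components_def card_graph_components)
qed

text \<open>Every glued edge comes from one block and stays in it, so each block is a union of
  components.\<close>

lemma card_le_ncomp_glued:
  assumes lab: "block_labeling f g" and X: "finite X" "\<pi> \<in> balanced_partitions X"
    and H: "H \<in> PiE \<pi> (\<lambda>b. labeled_graphs D (white_count b))"
  shows "card \<pi> \<le> ncomp X (\<Union>i\<in>{1..D}. sum_edges (glued_edges f g \<pi> H i))"
proof -
  have P: "partition_on X \<pi>" using X(2) by (simp add: balanced_partitions_def)
  show ?thesis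
  proof (rule card_partition_le_ncomp[OF X(1) P])
    fix b x y assume b: "b \<in> \<pi>" and "(x, y) \<in> (\<Union>i\<in>{1..D}. sum_edges (glued_edges f g \<pi> H i))"
    then obtain i v w where e: "x = Inl v" "y = Inr w" "i \<in> {1..D}" "(v, w) \<in> glued_edges f g \<pi> H i"
      by (auto simp: mem_sum_edges)
    then obtain c where c: "c \<in> \<pi>" "(v, w) \<in> map_prod (f c) (g c) ` edges (H c) i"
      by (auto simp: glued_edges_def)
    then have "v \<in> Inl -` c \<and> w \<in> Inr -` c"
      using block_matching[OF lab X c(1) H e(3)] unfolding perfect_matching_def by blast
    then have "x \<in> c" "y \<in> c" using e by simp_all
    then show "x \<in> b \<longleftrightarrow> y \<in> b" using partition_onD2[OF P] b c(1) by (auto simp: disjoint_def)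
  qed
qed

definition faces_glued ::
  "nat \<Rightarrow> ('w, 'b) colored_graph \<Rightarrow> (nat \<Rightarrow> ('w \<times> 'b) set) \<Rightarrow> nat" where
  "faces_glued D B m = (\<Sum>i = 1..D. ncomp (vertices B) (sum_edges (edges B i) \<union> sum_edges (m i)))"

text \<open>This is \<open>term_exponent\<close> < 0, rearranged. The triangle inequality trades
  faces between \<open>B\<close> and the glued colors for those of a covering graph; the faces
  between the glued colors and \<open>s\<close> are bounded below through \<open>C\<close>, and
  \<open>C\<close> lies between \<open>card \<pi>\<close> and the total number of components of the
  \<open>H b\<close>.\<close>

lemma faces_glued_less:
  fixes B :: "('w, 'b) colored_graph"
  assumes "D \<ge> 3" and B: "closed_colored_graph {1..D} B" and lab: "block_labeling f g"
    and \<pi>: "\<pi> \<in> balanced_partitions (vertices B)"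
    and H: "H \<in> PiE \<pi> (\<lambda>b. labeled_graphs D (white_count b))"
    and less: "card \<pi> < half_order B"
  shows "int (faces_glued D B (glued_edges f g \<pi> H)) + int D * int (card \<pi>) <
    int (Max (num_faces0 D ` covering_graphs D B)) + (int D - 1) * int (half_order B)
      + int (\<Sum>b\<in>\<pi>. num_components (H b))"
proof -
  let ?X = "white B <+> black B" and ?m = "glued_edges f g \<pi> H"
  have X: "vertices B = ?X" by (simp add: vertices_def)
  have fin: "finite (white B)" "finite (black B)" "card (white B) = card (black B)"
    using B by (auto simp: closed_colored_graph_def)
  have finX: "finite (vertices B)" using fin by (simp add: X)
  have m: "perfect_matching (white B) (black B) (?m i)" if "i \<in> {1..D}" for i
    using glued_edges_matching[OF lab finX \<pi> H that] by (simp add: X vimage_Plus)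
  define C where "C = ncomp ?X (\<Union>i\<in>{1..D}. sum_edges (?m i))"
  obtain s where s: "perfect_matching (white B) (black B) s" and
    sum_s: "(\<Sum>i = 1..D. ncomp ?X (sum_edges (?m i) \<union> sum_edges s)) \<ge>
      card (white B) + (D - 1) * C + (if C < card (white B) then 1 else 0)"
    unfolding C_def by (rule exists_good_matching[OF fin \<open>D \<ge> 3\<close> m])
  have "faces_glued D B ?m + (\<Sum>i = 1..D. ncomp ?X (sum_edges (?m i) \<union> sum_edges s)) \<le>
      (\<Sum>i = 1..D. ncomp ?X (sum_edges (edges B i) \<union> sum_edges s) + card (white B))"
    unfolding faces_glued_def X sum.distrib[symmetric]
    by (intro sum_mono ncomp_matching_triangle fin m s)
  also have "\<dots> = matching_faces D B s + D * half_order B"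
    by (simp add: matching_faces_def X sum.distrib half_order_def)
  also have "\<dots> \<le> Max (num_faces0 D ` covering_graphs D B) + D * half_order B"
    using matching_faces_le_Max[OF B s] by simp
  finally have "faces_glued D B ?m + half_order B + (D - 1) * C + (if C < half_order B then 1 else 0) \<le>
      Max (num_faces0 D ` covering_graphs D B) + D * half_order B"
    using sum_s by (simp add: half_order_def)
  then have "int (faces_glued D B ?m + half_order B + (D - 1) * C + (if C < half_order B then 1 else 0)) \<le>
      int (Max (num_faces0 D ` covering_graphs D B) + D * half_order B)"
    unfolding of_nat_le_iff .
  moreover have "int (D - 1) = int D - 1" using \<open>D \<ge> 3\<close> by simp
  ultimately have 1: "int (faces_glued D B ?m) + int (half_order B) + (int D - 1) * int C +
      (if C < half_order B then 1 else 0) \<le>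
      int (Max (num_faces0 D ` covering_graphs D B)) + int D * int (half_order B)"
    by (simp only: of_nat_add of_nat_mult) (simp split: if_splits)
  have "card \<pi> \<le> C" "C \<le> (\<Sum>b\<in>\<pi>. num_components (H b))"
    unfolding C_def X[symmetric]
    using card_le_ncomp_glued[OF lab finX \<pi> H] ncomp_glued_le[OF lab finX \<pi> H] by auto
  \<comment> \<open>Strictness has two sources: the bonus face if \<open>C < half_order B\<close>,
    and otherwise \<open>card \<pi> < half_order B \<le> C\<close>.\<close>
  moreover have "int D * int (card \<pi>) + (if C < half_order B then 0 else 1) \<le> int D * int C"
  proof (cases "C < half_order B")
    case False
    then have "int (card \<pi>) + 1 \<le> int C" using less by simp
    then have "int D * (int (card \<pi>) + 1) \<le> int D * int C" by (intro mult_left_mono) auto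
    then show ?thesis using False \<open>D \<ge> 3\<close> by (simp add: algebra_simps)
  next
    case True
    then show ?thesis using calculation by (simp add: mult_left_mono)
  qed
  moreover have "int C \<le> int (\<Sum>b\<in>\<pi>. num_components (H b))"
    using calculation(2) unfolding of_nat_le_iff .
  ultimately show ?thesis using 1
    by (cases "C < half_order B") (simp_all only: if_True if_False left_diff_distrib mult_1)
qed

section \<open>Partitions into pairs and dipoles\<close>

definition pairing_matching :: "('w + 'b) set set \<Rightarrow> ('w \<times> 'b) set" where
  "pairing_matching \<pi> = {(v, w). {Inl v, Inr w} \<in> \<pi>}"

text \<open>Every block has at least one white vertex, and there are only as many white vertices as
  blocks.\<close>

lemma pairing_white_count:
  assumes "finite X" "\<pi> \<in> balanced_partitions X" "card \<pi> = card (Inl -` X)" "b \<in> \<pi>"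
  shows "white_count b = 1"
proof (rule ccontr)
  assume "white_count b \<noteq> 1"
  have fin: "finite \<pi>" using assms(1,2) finite_elements by (auto simp: balanced_partitions_def)
  have ge: "1 \<le> white_count c" if "c \<in> \<pi>" for c using balanced_blockD(4)[OF assms(1,2) that] .
  have "1 < white_count b" using ge[OF assms(4)] \<open>white_count b \<noteq> 1\<close> by linarith
  then have "(\<Sum>c\<in>\<pi>. 1) < (\<Sum>c\<in>\<pi>. white_count c)"
    using fin ge assms(4) by (intro sum_strict_mono_ex1 bexI[of _ b]) auto
  then show False using sum_white_count[OF assms(1,2)] assms(3) by simp
qed

lemma card_le_half_order:
  assumes "finite X" "\<pi> \<in> balanced_partitions X"
  shows "card \<pi> \<le> card (Inl -` X)"
  using sum_mono[of \<pi> "\<lambda>_. 1" white_count] balanced_blockD(4)[OF assms] sum_white_count[OF assms] by simp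

text \<open>On a pair the dipole puts the same edge into every color, so the glued family does not
  depend on the color and can be read as a single color 0.\<close>

lemma glued_edges_pairing:
  assumes lab: "block_labeling f g" and X: "finite X" "\<pi> \<in> balanced_partitions X"
    and card: "card \<pi> = card (Inl -` X)" and i: "i \<in> {1..D}"
  shows "glued_edges f g \<pi> (\<lambda>b\<in>\<pi>. dipole D) i = pairing_matching \<pi>"
proof -
  have b: "b = {Inl (f b 1), Inr (g b 1)}" if "b \<in> \<pi>" for b
  proof -
    have "bij_betw (f b) {1..white_count b} (Inl -` b)" "bij_betw (g b) {1..white_count b} (Inr -` b)"
      using lab balanced_blockD[OF X that] by (auto simp: block_labeling_def)
    then have "Inl -` b = {f b 1}" "Inr -` b = {g b 1}"
      using pairing_white_count[OF X card that] by (simp_all add: bij_betw_def)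
    then show ?thesis using block_eq_Plus[of b] by (auto simp: Plus_def)
  qed
  have "glued_edges f g \<pi> (\<lambda>b\<in>\<pi>. dipole D) i = (\<Union>b\<in>\<pi>. {(f b 1, g b 1)})"
    using i by (simp add: glued_edges_def dipole_def)
  also have "\<dots> = pairing_matching \<pi>"
  proof (intro equalityI subrelI)
    fix v w assume "(v, w) \<in> (\<Union>b\<in>\<pi>. {(f b 1, g b 1)})"
    then obtain c where "c \<in> \<pi>" "v = f c 1" "w = g c 1" by auto
    then show "(v, w) \<in> pairing_matching \<pi>" using b[of c] by (simp add: pairing_matching_def)
  next
    fix v w assume "(v, w) \<in> pairing_matching \<pi>"
    then have c: "{Inl v, Inr w} \<in> \<pi>" by (simp add: pairing_matching_def)
    let ?c = "{Inl v, Inr w}"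
    have "{Inl v, Inr w} = {Inl (f ?c 1), Inr (g ?c 1)}" by (rule b[OF c])
    then have "v = f ?c 1" "w = g ?c 1" unfolding doubleton_eq_iff by simp_all
    then show "(v, w) \<in> (\<Union>b\<in>\<pi>. {(f b 1, g b 1)})" using c by blast
  qed
  finally show ?thesis .
qed

lemma labeled_graphs_pairing:
  assumes "finite X" "\<pi> \<in> balanced_partitions X" "card \<pi> = card (Inl -` X)"
  shows "PiE \<pi> (\<lambda>b. labeled_graphs D (white_count b)) = {\<lambda>b\<in>\<pi>. dipole D}"
proof -
  have "PiE \<pi> (\<lambda>b. labeled_graphs D (white_count b)) = PiE \<pi> (\<lambda>b. {dipole D})"
    using pairing_white_count[OF assms] labeled_graphs_1 by (intro PiE_cong) simp
  also have "\<dots> = PiE \<pi> (\<lambda>b. {(\<lambda>b\<in>\<pi>. dipole D) b})" by (intro PiE_cong) simp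
  also have "\<dots> = {\<lambda>b\<in>\<pi>. dipole D}" by (rule PiE_singleton) (rule restrict_extensional)
  finally show ?thesis .
qed

lemma bij_betw_pairing_matching:
  fixes V :: "'w set" and W :: "'b set"
  assumes fin: "finite V" "finite W"
  shows "bij_betw pairing_matching {\<pi> \<in> balanced_partitions (V <+> W). card \<pi> = card V}
    {s. perfect_matching V W s}"
proof -
  let ?X = "V <+> W" and ?pairs = "\<lambda>s. (\<lambda>(v, w). {Inl v, Inr w}) ` s"
  obtain f :: "('w + 'b) set \<Rightarrow> nat \<Rightarrow> 'w" and g :: "('w + 'b) set \<Rightarrow> nat \<Rightarrow> 'b"
    where lab: "block_labeling f g" using ex_block_labeling by metis
  have finX: "finite ?X" using fin by simp
  have block: "\<exists>v w. b = {Inl v, Inr w}"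
    if \<pi>: "\<pi> \<in> balanced_partitions ?X" "card \<pi> = card V" "b \<in> \<pi>" for \<pi> and b :: "('w + 'b) set"
  proof -
    have "card (Inl -` b) = 1"
      using pairing_white_count[OF finX \<pi>(1) _ \<pi>(3)] \<pi>(2) by (simp add: vimage_Plus white_count_def)
    moreover from this have "card (Inr -` b) = 1"
      using balanced_blockD(2)[OF finX \<pi>(1,3)] by (simp add: balanced_def)
    ultimately obtain v w where "Inl -` b = {v}" "Inr -` b = {w}" by (meson card_1_singletonE)
    then show ?thesis using block_eq_Plus[of b] by (intro exI[of _ v] exI[of _ w]) (auto simp: Plus_def)
  qed
  show ?thesis
  proof (rule bij_betw_byWitness[where f' = ?pairs])
    show "\<forall>\<pi>\<in>{\<pi> \<in> balanced_partitions ?X. card \<pi> = card V}. ?pairs (pairing_matching \<pi>) = \<pi>"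
      using block unfolding pairing_matching_def by (fastforce simp: image_iff)
    show "\<forall>s\<in>{s. perfect_matching V W s}. pairing_matching (?pairs s) = s"
      by (auto simp: pairing_matching_def doubleton_eq_iff)
    show "pairing_matching ` {\<pi> \<in> balanced_partitions ?X. card \<pi> = card V} \<subseteq> {s. perfect_matching V W s}"
    proof (intro image_subsetI CollectI)
      fix \<pi> assume "\<pi> \<in> {\<pi> \<in> balanced_partitions ?X. card \<pi> = card V}"
      then have \<pi>: "\<pi> \<in> balanced_partitions ?X" "card \<pi> = card (Inl -` ?X)" by (simp_all add: vimage_Plus)
      \<comment> \<open>The matching is the same in every color, so graphs with one color suffice to
        borrow the matching property of glued families.\<close>
      have "perfect_matching (Inl -` ?X) (Inr -` ?X) (glued_edges f g \<pi> (\<lambda>b\<in>\<pi>. dipole 1) 1)"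
      proof (rule glued_edges_matching[OF lab finX \<pi>(1)])
        show "(\<lambda>b\<in>\<pi>. dipole 1) \<in> PiE \<pi> (\<lambda>b. labeled_graphs 1 (white_count b))"
          by (simp only: labeled_graphs_pairing[OF finX \<pi>] singletonI)
      qed simp
      then show "perfect_matching V W (pairing_matching \<pi>)"
        by (simp add: glued_edges_pairing[OF lab finX \<pi>] vimage_Plus)
    qed
    show "?pairs ` {s. perfect_matching V W s} \<subseteq> {\<pi> \<in> balanced_partitions ?X. card \<pi> = card V}"
    proof (intro image_subsetI CollectI conjI)
      fix s assume "s \<in> {s. perfect_matching V W s}"
      then have s: "perfect_matching V W s" by simp
      have "inj_on (\<lambda>(v, w). {Inl v, Inr w} :: ('w + 'b) set) s"
        by (auto simp: inj_on_def doubleton_eq_iff)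
      then show "card (?pairs s) = card V" using card_perfect_matching[OF s] by (simp add: card_image)
      have "partition_on ?X (?pairs s)"
      proof (rule partition_onI)
        obtain h where h: "bij_betw h V W" "s = {(v, h v) | v. v \<in> V}" by (rule perfect_matchingE[OF s])
        then have "inj_on h V" "W = h ` V" by (auto simp: bij_betw_def)
        then show "\<Union> (?pairs s) = ?X"
          unfolding h(2) by (auto simp: Plus_def image_iff)
        fix p q assume "p \<in> ?pairs s" "q \<in> ?pairs s" "p \<noteq> q"
        then show "disjnt p q" using \<open>inj_on h V\<close> unfolding h(2) by (auto simp: disjnt_def dest: inj_onD)
      qed auto
      moreover have "balanced b" if b: "b \<in> ?pairs s" for b
      proof -
        obtain v w where "b = {Inl v, Inr w}" using b by auto
        then have "Inl -` b = {v}" "Inr -` b = {w}" by auto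
        then show ?thesis by (simp add: balanced_def)
      qed
      ultimately show "?pairs s \<in> balanced_partitions ?X" by (simp add: balanced_partitions_def)
    qed
  qed
qed

section \<open>Scaling limit\<close>

text \<open>The boundedness clause leaves out the dipole, whose coefficient is bounded because it
  converges.\<close>

lemma rescaled_coeff_bounded:
  assumes "properly_uniformly_bounded D \<KK>" "k \<ge> 1" "H \<in> labeled_graphs D k"
  shows "\<exists>c::real. \<forall>\<^sub>F N in sequentially. norm (rescaled_coeff D \<KK> H N) \<le> c"
proof (cases "H = dipole D")
  case True
  have "Bseq (rescaled_coeff D \<KK> (dipole D))"
    using assms(1) unfolding properly_uniformly_bounded_def by (intro convergent_imp_Bseq) simp
  then obtain c where "\<And>N. norm (rescaled_coeff D \<KK> (dipole D) N) \<le> c" by (auto simp: Bseq_def)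
  then show ?thesis using True by (intro exI[of _ c]) simp
next
  case False
  then show ?thesis using assms unfolding properly_uniformly_bounded_def by blast
qed

lemma prod_eventually_bounded:
  fixes F :: "'c \<Rightarrow> nat \<Rightarrow> complex"
  assumes "finite P" "\<And>b. b \<in> P \<Longrightarrow> \<exists>c::real. \<forall>\<^sub>F N in sequentially. norm (F b N) \<le> c"
  shows "\<exists>c::real. \<forall>\<^sub>F N in sequentially. norm (\<Prod>b\<in>P. F b N) \<le> c"
  using assms
proof (induction P rule: finite_induct)
  case (insert b P)
  obtain c where c: "\<forall>\<^sub>F N in sequentially. norm (F b N) \<le> c" using insert.prems by auto
  obtain d where d: "\<forall>\<^sub>F N in sequentially. norm (\<Prod>b\<in>P. F b N) \<le> d" using insert by auto
  have "\<forall>\<^sub>F N in sequentially. norm (\<Prod>b\<in>insert b P. F b N) \<le> c * d"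
    using c d
  proof eventually_elim
    case (elim N)
    have "0 \<le> c" using norm_ge_zero elim(1) by (rule order_trans)
    then have "norm (F b N) * norm (\<Prod>b\<in>P. F b N) \<le> c * d"
      using elim by (intro mult_mono) auto
    then show ?case using insert.hyps by (simp add: norm_mult)
  qed
  then show ?case by blast
qed (auto intro!: exI[of _ 1])

text \<open>A negative integer exponent is at most -1, so \<open>c / N\<close> dominates from
  \<open>N = 1\<close> on.\<close>

lemma bounded_times_negative_power_tendsto_0:
  fixes F :: "nat \<Rightarrow> complex"
  assumes "\<forall>\<^sub>F N in sequentially. norm (F N) \<le> c" "e < 0"
  shows "(\<lambda>N. F N * of_nat N powi e) \<longlonglongrightarrow> 0"
proof (rule Lim_null_comparison)
  show "\<forall>\<^sub>F N in sequentially. norm (F N * of_nat N powi e) \<le> c * inverse (real N)"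
    using assms(1) eventually_ge_at_top[of 1]
  proof eventually_elim
    case (elim N)
    have "real N powi e \<le> real N powi (- 1)"
      using elim(2) assms(2) by (intro power_int_increasing) auto
    then have "real N powi e \<le> inverse (real N)" by (simp add: power_int_minus)
    moreover have "0 \<le> c" using elim(1) norm_ge_zero order_trans by blast
    ultimately have "norm (F N) * real N powi e \<le> c * inverse (real N)"
      using elim(1) by (intro mult_mono) (auto simp: zero_le_power_int)
    then show ?case by (simp add: norm_mult norm_power_int)
  qed
  show "(\<lambda>N. c * inverse (real N)) \<longlonglongrightarrow> 0"
    using tendsto_mult_right[OF lim_inverse_n, of c] by (simp add: mult.commute)
qed

section \<open>Powers of N in the rescaled terms\<close>

definition scaling_exponent :: "nat \<Rightarrow> (nat, nat) colored_graph \<Rightarrow> int" where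
  "scaling_exponent D H =
     - 2 * (int D - 1) * int (half_order H) + int D - int (num_components H)"

lemma coeff_eq_rescaled:
  assumes "N \<ge> 1"
  shows "\<KK> N H = rescaled_coeff D \<KK> H N * of_nat N powi scaling_exponent D H"
  using assms by (simp add: rescaled_coeff_def scaling_exponent_def power_int_eq_0_iff)

lemma prod_powi_complex:
  assumes "(x::complex) \<noteq> 0" "finite P"
  shows "(\<Prod>b\<in>P. x powi e b) = x powi (\<Sum>b\<in>P. e b)"
  using assms(2) by (induction P rule: finite_induct) (simp_all add: power_int_add assms(1))

lemma sum_scaling_exponent:
  assumes "finite X" "\<pi> \<in> balanced_partitions X"
    and H: "H \<in> PiE \<pi> (\<lambda>b. labeled_graphs D (white_count b))"
  shows "(\<Sum>b\<in>\<pi>. scaling_exponent D (H b)) =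
    - 2 * (int D - 1) * int (card (Inl -` X)) + int D * int (card \<pi>) - int (\<Sum>b\<in>\<pi>. num_components (H b))"
proof -
  have "half_order (H b) = white_count b" if "b \<in> \<pi>" for b
    using PiE_mem[OF H that] by (simp add: labeled_graphs_def half_order_def)
  then have "(\<Sum>b\<in>\<pi>. scaling_exponent D (H b)) =
      (\<Sum>b\<in>\<pi>. - 2 * (int D - 1) * int (white_count b) + int D - int (num_components (H b)))"
    unfolding scaling_exponent_def by (intro sum.cong) simp_all
  also have "\<dots> = - 2 * (int D - 1) * int (\<Sum>b\<in>\<pi>. white_count b) + int D * int (card \<pi>)
      - int (\<Sum>b\<in>\<pi>. num_components (H b))"
    by (simp add: sum_subtractf sum.distrib sum_distrib_left[symmetric] sum_negf)
  finally show ?thesis unfolding sum_white_count[OF assms(1,2)] .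
qed

text \<open>The total of \<open>- 1 + Omega D B\<close>, the scaling exponents of the blocks and the
  number of faces. The first brings \<open>(D - 1) * half_order B\<close> minus the maximum and the
  second \<open>- 2 * (D - 1) * half_order B\<close>, which leaves one negative copy.\<close>

definition term_exponent ::
  "nat \<Rightarrow> ('w, 'b) colored_graph \<Rightarrow> ('w + 'b) set set \<Rightarrow> (('w + 'b) set \<Rightarrow> (nat, nat) colored_graph) \<Rightarrow>
    (nat \<Rightarrow> ('w \<times> 'b) set) \<Rightarrow> int" where
  "term_exponent D B \<pi> H m = int (faces_glued D B m) + int D * int (card \<pi>)
     - int (Max (num_faces0 D ` covering_graphs D B)) - (int D - 1) * int (half_order B)
     - int (\<Sum>b\<in>\<pi>. num_components (H b))"

lemma scaled_term:
  fixes B :: "('w, 'b) colored_graph"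
  assumes "closed_colored_graph {1..D} B" "\<pi> \<in> balanced_partitions (vertices B)"
    and H: "H \<in> PiE \<pi> (\<lambda>b. labeled_graphs D (white_count b))" and "N \<ge> 1"
  shows "of_nat N powi (- 1 + Omega D B) * ((\<Prod>b\<in>\<pi>. \<KK> N (H b)) * of_nat N ^ faces_glued D B m) =
    (\<Prod>b\<in>\<pi>. rescaled_coeff D \<KK> (H b) N) * of_nat N powi term_exponent D B \<pi> H m"
proof -
  have X: "finite (vertices B)" "Inl -` vertices B = white B"
    using assms(1) by (auto simp: closed_colored_graph_def vertices_def)
  have fin: "finite \<pi>" using X(1) assms(2) finite_elements by (auto simp: balanced_partitions_def)
  have N: "(of_nat N :: complex) \<noteq> 0" using assms(4) by simp
  have "(\<Prod>b\<in>\<pi>. \<KK> N (H b)) = (\<Prod>b\<in>\<pi>. rescaled_coeff D \<KK> (H b) N) *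
      of_nat N powi (\<Sum>b\<in>\<pi>. scaling_exponent D (H b))"
    by (simp add: coeff_eq_rescaled[OF assms(4), of \<KK> _ D] prod.distrib prod_powi_complex[OF N fin])
  moreover have "- 1 + Omega D B + (\<Sum>b\<in>\<pi>. scaling_exponent D (H b)) + int (faces_glued D B m) =
      term_exponent D B \<pi> H m"
    unfolding sum_scaling_exponent[OF X(1) assms(2) H] X(2) Omega_def term_exponent_def half_order_def
    by (simp add: algebra_simps)
  ultimately show ?thesis
    using N by (simp add: power_int_add[symmetric] ac_simps flip: power_int_of_nat)
qed

text \<open>A bounded product times a negative power of \<open>N\<close> vanishes. Exponent zero is
  left only for pairings attaining the maximum, and there every factor is the dipole
  coefficient.\<close>

lemma term_tendsto:
  fixes B :: "('w, 'b) colored_graph"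
  assumes "D \<ge> 3" and bounded: "properly_uniformly_bounded D \<KK>"
    and B: "closed_colored_graph {1..D} B" and lab: "block_labeling f g"
    and \<pi>: "\<pi> \<in> balanced_partitions (vertices B)"
    and H: "H \<in> PiE \<pi> (\<lambda>b. labeled_graphs D (white_count b))"
  defines "m \<equiv> glued_edges f g \<pi> H" and "\<kappa> \<equiv> lim (rescaled_coeff D \<KK> (dipole D))"
  shows "(\<lambda>N. (\<Prod>b\<in>\<pi>. rescaled_coeff D \<KK> (H b) N) * of_nat N powi term_exponent D B \<pi> H m)
    \<longlonglongrightarrow> (if card \<pi> = half_order B \<and>
            matching_faces D B (pairing_matching \<pi>) = Max (num_faces0 D ` covering_graphs D B)
          then \<kappa> ^ half_order B else 0)"
proof -
  let ?M = "Max (num_faces0 D ` covering_graphs D B)"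
  have X: "finite (vertices B)" "Inl -` vertices B = white B" "Inr -` vertices B = black B"
    using B by (auto simp: closed_colored_graph_def vertices_def)
  have fin: "finite \<pi>" using X(1) \<pi> finite_elements by (auto simp: balanced_partitions_def)
  have "\<exists>c::real. \<forall>\<^sub>F N in sequentially. norm (\<Prod>b\<in>\<pi>. rescaled_coeff D \<KK> (H b) N) \<le> c"
    using rescaled_coeff_bounded[OF bounded balanced_blockD(4)[OF X(1) \<pi>] PiE_mem[OF H]] fin
    by (intro prod_eventually_bounded) auto
  then obtain c where c: "\<forall>\<^sub>F N in sequentially. norm (\<Prod>b\<in>\<pi>. rescaled_coeff D \<KK> (H b) N) \<le> c" by blast
  note null = bounded_times_negative_power_tendsto_0[OF c]
  show ?thesis
  proof (cases "card \<pi> = half_order B")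
    case False
    then have "card \<pi> < half_order B"
      using card_le_half_order[OF X(1) \<pi>] by (simp add: half_order_def X)
    then have "term_exponent D B \<pi> H m < 0"
      using faces_glued_less[OF \<open>D \<ge> 3\<close> B lab \<pi> H] by (simp add: term_exponent_def m_def)
    then show ?thesis using null False by simp
  next
    case True
    then have card: "card \<pi> = card (Inl -` vertices B)" by (simp add: half_order_def X)
    have Heq: "H = (\<lambda>b\<in>\<pi>. dipole D)" using H labeled_graphs_pairing[OF X(1) \<pi> card, of D] by simp
    have m: "m i = pairing_matching \<pi>" if "i \<in> {1..D}" for i
      using glued_edges_pairing[OF lab X(1) \<pi> card that] by (simp add: m_def Heq)
    have "perfect_matching (white B) (black B) (m 1)"
      unfolding m_def using glued_edges_matching[OF lab X(1) \<pi> H, of 1] \<open>D \<ge> 3\<close> by (simp add: X)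
    then have le: "matching_faces D B (pairing_matching \<pi>) \<le> ?M"
      using m[of 1] \<open>D \<ge> 3\<close> by (intro matching_faces_le_Max[OF B]) simp
    have "(\<Sum>b\<in>\<pi>. num_components (H b)) = card \<pi>"
      using num_components_dipole[of D] \<open>D \<ge> 3\<close> by (simp add: Heq)
    moreover have "faces_glued D B m = matching_faces D B (pairing_matching \<pi>)"
      unfolding faces_glued_def matching_faces_def using m by (intro sum.cong) simp_all
    \<comment> \<open>With k blocks that are single-component dipoles,
      \<open>D * k - (D - 1) * k - k\<close> cancels and only the face deficit remains.\<close>
    ultimately have e: "term_exponent D B \<pi> H m = int (matching_faces D B (pairing_matching \<pi>)) - int ?M"
      by (simp add: term_exponent_def True algebra_simps)
    show ?thesis
    proof (cases "matching_faces D B (pairing_matching \<pi>) = ?M")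
      case eq: True
      have "rescaled_coeff D \<KK> (dipole D) \<longlonglongrightarrow> \<kappa>"
        using bounded unfolding properly_uniformly_bounded_def \<kappa>_def by (simp add: convergent_LIMSEQ_iff)
      then have "(\<lambda>N. rescaled_coeff D \<KK> (dipole D) N ^ half_order B) \<longlonglongrightarrow> \<kappa> ^ half_order B"
        by (rule tendsto_power)
      moreover have "term_exponent D B \<pi> H m = 0" using eq by (simp add: e)
      moreover have "(\<Prod>b\<in>\<pi>. rescaled_coeff D \<KK> (H b) N) =
          rescaled_coeff D \<KK> (dipole D) N ^ half_order B" for N
        by (simp add: Heq True)
      ultimately show ?thesis using eq True by simp
    next
      case False
      then have "term_exponent D B \<pi> H m < 0" using le by (simp add: e)
      then show ?thesis using null False by simp
    qed
  qed
qed

theorem theorem2: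
  fixes D :: nat
    and M :: "nat \<Rightarrow> 'a measure"
    and T :: "nat \<Rightarrow> (nat \<Rightarrow> nat) \<Rightarrow> 'a \<Rightarrow> complex"
    and \<KK> :: "nat \<Rightarrow> (nat, nat) colored_graph \<Rightarrow> complex"
    and B :: "('w, 'b) colored_graph"
  assumes "D \<ge> 3"
    and "\<And>N. N \<ge> 1 \<Longrightarrow> random_tensor D N (M N) (T N)"
    and "\<And>N. N \<ge> 1 \<Longrightarrow> finite_moments D N (M N) (T N)"
    and "\<And>N. N \<ge> 1 \<Longrightarrow> even_distribution D N (M N) (T N)"
    and "\<And>N. N \<ge> 1 \<Longrightarrow> trace_invariant D N (M N) (T N) (\<KK> N)"
    and "properly_uniformly_bounded D \<KK>"
    and "closed_colored_graph {1..D} B"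
    and "connected_graph B"
  shows "(\<lambda>N. of_nat N powi (- 1 + Omega D B) * (\<integral>\<omega>. trace_inv D N B (\<lambda>n. T N n \<omega>) \<partial>M N))
    \<longlonglongrightarrow> lim (rescaled_coeff D \<KK> (dipole D)) ^ half_order B * of_nat (R_number D B)"
proof -
  obtain f :: "('w + 'b) set \<Rightarrow> nat \<Rightarrow> 'w" and g :: "('w + 'b) set \<Rightarrow> nat \<Rightarrow> 'b"
    where lab: "block_labeling f g" using ex_block_labeling by metis
  note B = \<open>closed_colored_graph {1..D} B\<close>
  let ?X = "vertices B" and ?P = "\<lambda>\<pi>. PiE \<pi> (\<lambda>b. labeled_graphs D (white_count b))"
  let ?M = "Max (num_faces0 D ` covering_graphs D B)"
  let ?\<kappa> = "lim (rescaled_coeff D \<KK> (dipole D)) ^ half_order B"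
  let ?L = "\<lambda>\<pi>. if card \<pi> = half_order B \<and> matching_faces D B (pairing_matching \<pi>) = ?M then ?\<kappa> else 0"
  have X: "?X = white B <+> black B" "finite (white B)" "finite (black B)"
    using B by (auto simp: vertices_def closed_colored_graph_def)
  have finX: "finite ?X" and InlX: "Inl -` ?X = white B" using X by (auto simp: vimage_Plus)
  \<comment> \<open>A graph with one component has a vertex, so the moment-cumulant relation applies
    to the full vertex set.\<close>
  have ne: "?X \<noteq> {}"
    using \<open>connected_graph B\<close>
    by (auto simp: connected_graph_def num_components_def graph_components_def quotient_def)
  have eq: "of_nat N powi (- 1 + Omega D B) * (\<integral>\<omega>. trace_inv D N B (\<lambda>n. T N n \<omega>) \<partial>M N) =
      (\<Sum>\<pi>\<in>balanced_partitions ?X. \<Sum>H\<in>?P \<pi>. (\<Prod>b\<in>\<pi>. rescaled_coeff D \<KK> (H b) N) *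
        of_nat N powi term_exponent D B \<pi> H (glued_edges f g \<pi> H))" if "N \<ge> 1" for N
    unfolding expected_trace_expansion[OF B ne assms(3)[OF that] assms(5)[OF that] lab] sum_distrib_left
    by (intro sum.cong refl scaled_term[OF B _ _ that, unfolded faces_glued_def])
  have "(\<lambda>N. \<Sum>\<pi>\<in>balanced_partitions ?X. \<Sum>H\<in>?P \<pi>. (\<Prod>b\<in>\<pi>. rescaled_coeff D \<KK> (H b) N) *
        of_nat N powi term_exponent D B \<pi> H (glued_edges f g \<pi> H))
      \<longlonglongrightarrow> (\<Sum>\<pi>\<in>balanced_partitions ?X. \<Sum>H\<in>?P \<pi>. ?L \<pi>)"
    by (intro tendsto_sum term_tendsto[OF assms(1,6) B lab])
  \<comment> \<open>On a partition into pairs the only choice is the dipole in every block, so the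
    inner sum is a single term; on all other partitions the limits are zero.\<close>
  also have "(\<Sum>\<pi>\<in>balanced_partitions ?X. \<Sum>H\<in>?P \<pi>. ?L \<pi>) =
      (\<Sum>\<pi>\<in>balanced_partitions ?X. if card \<pi> = half_order B then ?L \<pi> else 0)"
  proof (rule sum.cong)
    fix \<pi> assume \<pi>: "\<pi> \<in> balanced_partitions ?X"
    show "(\<Sum>H\<in>?P \<pi>. ?L \<pi>) = (if card \<pi> = half_order B then ?L \<pi> else 0)"
      using labeled_graphs_pairing[OF finX \<pi>, of D] by (cases "card \<pi> = half_order B") (simp_all add: InlX half_order_def)
  qed simp
  also have "\<dots> = (\<Sum>\<pi>\<in>{\<pi> \<in> balanced_partitions ?X. card \<pi> = card (white B)}.
      if matching_faces D B (pairing_matching \<pi>) = ?M then ?\<kappa> else 0)"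
    unfolding half_order_def
    by (subst sum.inter_filter[OF finite_balanced_partitions[OF finX], symmetric]) (intro sum.cong, auto)
  \<comment> \<open>Pairs become edges of color 0: the sum now runs over the covering graphs of
    \<open>B\<close>, and the minimal ones contribute.\<close>
  also have "\<dots> = (\<Sum>s\<in>{s. perfect_matching (white B) (black B) s}. if matching_faces D B s = ?M then ?\<kappa> else 0)"
    unfolding X(1) by (rule sum.reindex_bij_betw[OF bij_betw_pairing_matching[OF X(2,3)]])
  also have "\<dots> = ?\<kappa> * of_nat (R_number D B)"
  proof -
    have "{s. perfect_matching (white B) (black B) s} \<subseteq> Pow (white B \<times> black B)"
      by (auto simp: perfect_matching_def)
    then have "finite {s. perfect_matching (white B) (black B) s}"
      using X(2,3) finite_subset by blast
    then show ?thesis by (subst sum.inter_filter[symmetric]) (simp_all add: R_number_eq[OF B])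
  qed
  \<comment> \<open>The expansion is available for \<open>N \<ge> 1\<close> only, which is enough
    for the limit.\<close>
  finally show ?thesis
    by (rule Lim_transform_eventually) (use eq in \<open>auto intro: eventually_sequentiallyI[of 1]\<close>)
qed

end
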